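(* Let $k\in\{0,1,2,\dots\}$, let $\rho\in\mathbb{C}$ with $|\rho|<1$, and let $a,b,c,d,h$ be complex parameters with positive real parts, such that the non-real parameters occur in conjugate pairs among $a,b,c,d$ and also among $a,b,c,h$. Then $$ \int_0^\infty {}_2F_1\!\left(\begin{matrix}a+ix,\ c+ix\\ a+c\end{matrix};\rho\right){}_2F_1\!\left(\begin{matrix}b-ix,\ d-ix\\ b+d\end{matrix};\rho\right)W_k(x^2;a,b,c,h)\left|\frac{\Gamma(a+ix)\Gamma(b+ix)\Gamma(c+ix)\Gamma(h+ix)}{\Gamma(2ix)}\right|^2dx $$ $$ =2\pi\,\frac{\Gamma(a+c)\Gamma(k+a+b)\Gamma(k+a+h)\Gamma(k+b+c)\Gamma(k+c+h)\Gamma(k+b+h)\,(k+a+b+c+d-1)_k}{(b+d)_k\,\Gamma(2k+a+b+c+h)} $$ $$ \times\ {}_4F_3\!\left(\begin{matrix}d-h,\ 2k+a+b+c+d-1,\ k+a+b,\ k+b+c\\ k+a+b+c+d-1,\ 2k+a+b+c+h,\ k+b+d\end{matrix};\rho\right)\rho^k. $$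
   Context: The Pochhammer symbol is $(z)_n=\prod_{i=1}^n(z+i-1)$ (so $(z)_0=1$). The generalized hypergeometric function is ${}_pF_q(a_1,\dots,a_p;b_1,\dots,b_q;z)=\sum_{n\ge0}\frac{(a_1)_n\cdots(a_p)_n}{(b_1)_n\cdots(b_q)_n}\frac{z^n}{n!}$; for $p=q+1$ the series converges for $|z|<1$. The Wilson polynomials are $$W_n(x^2;a,b,c,d)=(a+b)_n(a+c)_n(a+d)_n\ {}_4F_3\!\left(\begin{matrix}-n,\ n+a+b+c+d-1,\ a+ix,\ a-ix\\ a+b,\ a+c,\ a+d\end{matrix};1\right).$$ Convention: for $k=0$, the numerator parameter $2k+a+b+c+d-1$ and the denominator parameter $k+a+b+c+d-1$ of the ${}_4F_3$ on the right coincide and are cancelled (this matters only if $a+b+c+d=1$). *)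

theory Defs
  imports "HOL-Analysis.Analysis" "HOL-Library.Multiset"
begin

definition hypergeo :: "complex list \<Rightarrow> complex list \<Rightarrow> complex \<Rightarrow> complex" where
  "hypergeo as bs z = eval_fps (fps_hypergeo as bs 1) z"

lemma foldl_mult_eq_prod_list:
  "foldl (\<lambda>r a. r * f a) (c :: 'a :: comm_monoid_mult) xs = c * prod_list (map f xs)"
  by (induction xs arbitrary: c) (simp_all add: mult.assoc)

lemma hypergeo_altdef:
  "hypergeo as bs z =
     (\<Sum>n. prod_list (map (\<lambda>a. pochhammer a n) as) / prod_list (map (\<lambda>b. pochhammer b n) bs)
            * (z ^ n / fact n))"
  by (simp add: hypergeo_def eval_fps_def foldl_mult_eq_prod_list)

(* The value W_n(x^2; a, b, c, d): the variable is x, not x^2. The right-hand side is even in x. *)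
definition wilson ::
  "nat \<Rightarrow> complex \<Rightarrow> complex \<Rightarrow> complex \<Rightarrow> complex \<Rightarrow> complex \<Rightarrow> complex" where
  "wilson n x a b c d =
     pochhammer (a + b) n * pochhammer (a + c) n * pochhammer (a + d) n *
     hypergeo [- of_nat n, of_nat n + a + b + c + d - 1, a + \<i> * x, a - \<i> * x]
              [a + b, a + c, a + d] 1"

end

theory Submission
  imports Defs "HOL-Complex_Analysis.Complex_Analysis" "HOL-Real_Asymp.Real_Asymp"
begin

text \<open>
  Put \<open>y = \<i> x\<close>. The coefficient of \<open>\<rho>\<^sup>n\<close> in the product of the two \<open>\<^sub>2F\<^sub>1\<close> series is, up to a constant, the
  Wilson polynomial with parameters \<open>a, b, c, d\<close>, and it can be expanded in the basis
  \<open>(b + y)\<^sub>M (b - y)\<^sub>M\<close>. Expanding \<open>W\<^sub>k\<close> in the basis \<open>(a + y)\<^sub>i (a - y)\<^sub>i\<close> turns every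
  term into the Wilson weight with shifted parameters \<open>a + i\<close> and \<open>b + M\<close>. The de Branges-Wilson
  integral evaluates each of them, and the resulting double sum collapses by applying the
  Pfaff-Saalschuetz theorem twice.

  The de Branges-Wilson integral itself follows from its functional equation under \<open>a \<mapsto> a + 1\<close>,
  obtained by shifting the contour of \<open>sin (2\<pi>s) \<Prod>\<Gamma>(a\<^sub>j + 1/2 \<plusminus> s)\<close>. The ratio of the two sides is
  then invariant under this shift, and its limit for \<open>a \<rightarrow> \<infinity>\<close> does not involve \<open>a\<close>; by symmetry
  the ratio is constant, and it is computed at \<open>a = b = c = d = 1/2\<close>.

  Sum and integral may be exchanged because the partial sums grow at most like \<open>exp (\<theta> \<bar>x\<bar>)\<close> with
  \<open>\<theta> < 2\<pi>\<close>, whereas the weight decays faster than \<open>exp (-\<theta>' \<bar>x\<bar>)\<close> for every \<open>\<theta>' < 2\<pi>\<close>.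
\<close>

text \<open>The coefficient polynomials carry the parameters a, b, c, d, the weight a, b, c, h. The
  base points of both expansions are therefore taken from the shared parameters, and they are kept
  distinct: W_k is expanded about a, the coefficient about b, so that each basis product moves its
  own parameter of the weight. The sum over the expansion of W_k yields (-M)_k, which vanishes for M
  < k; this orthogonality is the origin of the factor \<rho>^k.

  The contour shift needs a weight holomorphic in s = ix, which a squared modulus is not. Hence
  Gamma(a + s) Gamma(a - s) takes the place of |Gamma(a + ix)|^2; conjugation symmetry of a, b, c, h
  identifies the two products for real x.

  The threshold 2\<pi> is a balance of exponential rates. Four Gamma pairs decay at any rate below
  \<pi> each, and the kernel 1/(Gamma(2s) Gamma(-2s)) grows at any rate above 2\<pi>, which leaves
  2\<pi>. Each 2F1 has two numerator symbols, both of growth rate strictly below \<pi>/2, so the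
  product of the two series stays strictly below 2\<pi>.\<close>

section \<open>Summation formulas for Pochhammer symbols\<close>

text \<open>
  Multiplying out denominators makes the Pfaff-Saalschuetz theorem an identity in any commutative
  ring. With \<open>X = C + q\<close>, the induction step rests on
  \<open>(X - u)(X - v) = (u + i)(v + i) + (X + i)(X - u - v - i)\<close>.
\<close>
lemma saalschuetz_pochhammer:
  fixes C u v :: "'a :: comm_ring_1"
  shows "pochhammer (C - u) q * pochhammer (C - v) q =
    (\<Sum>i\<le>q. of_nat (q choose i) * pochhammer u i * pochhammer v i *
           pochhammer (C + of_nat i) (q - i) * pochhammer (C - u - v) (q - i))"
proof (induction q)
  case 0
  then show ?case by simp
next
  case (Suc q)
  define E where "E = C - u - v"
  define t where "t = (\<lambda>q i. of_nat (q choose i) * pochhammer (C + of_nat i) (q - i) * pochhammer E (q - i))"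
  define b where "b = (\<lambda>i. pochhammer u i * pochhammer v i)"
  define f where "f = (\<lambda>i. (C + of_nat q + of_nat i) * (E + of_nat q - of_nat i))"
  \<comment> \<open>A weighted Pascal rule. Once the common Pochhammer factors are removed it rests
    on \<open>(q choose i) * (q - i) = (q choose Suc i) * Suc i\<close>.\<close>
  have t_rec: "t (Suc q) (Suc i) = t q i + t q (Suc i) * f (Suc i)" if "i \<le> q" for i
  proof (cases "i = q")
    case True
    then show ?thesis by (simp add: t_def binomial_eq_0)
  next
    case False
    with that obtain r where r: "q = Suc (i + r)"
      by (metis less_natE nat_less_le)
    have ch: "of_nat (q choose i) * (of_nat (Suc r) :: 'a) = of_nat (q choose Suc i) * of_nat (Suc i)"
    proof -
      have "(q choose i) * (q - i) = (q choose Suc i) * Suc i"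
        using binomial_absorb_comp[of q i] binomial_absorption[of i q] by (metis mult.commute)
      then show ?thesis
        using r by (simp only: of_nat_mult [symmetric]) simp
    qed
    define P where "P = pochhammer (C + of_nat (Suc i)) r"
    define R where "R = pochhammer E (Suc r)"
    have P1: "pochhammer (C + of_nat i) (Suc r) = (C + of_nat i) * P"
      by (simp add: P_def pochhammer_rec add_ac)
    have P2: "pochhammer (C + of_nat (Suc i)) (Suc r) = P * (C + of_nat i + of_nat (Suc r))"
      by (simp add: P_def pochhammer_Suc add_ac)
    have R1: "R = pochhammer E r * (E + of_nat r)"
      by (simp add: R_def pochhammer_Suc)
    have lhs: "t (Suc q) (Suc i) = (of_nat (q choose i) + of_nat (q choose Suc i)) * (P * (C + of_nat i + of_nat (Suc r))) * R"
      using r by (simp add: t_def P2 [simplified] R_def)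
    have rhs1: "t q i = of_nat (q choose i) * ((C + of_nat i) * P) * R"
      using r by (simp add: t_def P1 [simplified] R_def)
    have tS: "t q (Suc i) = of_nat (q choose Suc i) * P * pochhammer E r"
      using r by (simp add: t_def P_def)
    have fS: "f (Suc i) = (C + of_nat i + of_nat (Suc r) + of_nat (Suc i)) * (E + of_nat r)"
      using r by (simp add: f_def algebra_simps)
    have rhs2: "t q (Suc i) * f (Suc i) =
        of_nat (q choose Suc i) * P * (C + of_nat i + of_nat (Suc r) + of_nat (Suc i)) * R"
      by (simp only: tS fS R1 mult_ac)
    have "(of_nat (q choose i) + of_nat (q choose Suc i)) * (C + of_nat i + of_nat (Suc r)) =
       of_nat (q choose i) * (C + of_nat i) +
       of_nat (q choose Suc i) * (C + of_nat i + of_nat (Suc r) + of_nat (Suc i))"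
      using ch by (simp only: distrib_left distrib_right) (simp add: algebra_simps)
    then have "(of_nat (q choose i) + of_nat (q choose Suc i)) * (C + of_nat i + of_nat (Suc r)) * (P * R) =
       (of_nat (q choose i) * (C + of_nat i) +
       of_nat (q choose Suc i) * (C + of_nat i + of_nat (Suc r) + of_nat (Suc i))) * (P * R)"
      by simp
    then show ?thesis
      unfolding lhs rhs1 rhs2 by (simp add: algebra_simps)
  qed
  have b_rec: "b i * ((C + of_nat q - u) * (C + of_nat q - v)) = b (Suc i) + f i * b i" for i
    by (simp add: b_def f_def E_def pochhammer_Suc algebra_simps)
  have "pochhammer (C - u) (Suc q) * pochhammer (C - v) (Suc q) =
      (pochhammer (C - u) q * pochhammer (C - v) q) * ((C + of_nat q - u) * (C + of_nat q - v))"
    by (simp add: pochhammer_Suc algebra_simps)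
  also have "pochhammer (C - u) q * pochhammer (C - v) q = (\<Sum>i\<le>q. t q i * b i)"
    unfolding Suc.IH by (intro sum.cong) (simp_all add: t_def b_def E_def mult_ac)
  also have "(\<Sum>i\<le>q. t q i * b i) * ((C + of_nat q - u) * (C + of_nat q - v)) =
      (\<Sum>i\<le>q. t q i * (b i * ((C + of_nat q - u) * (C + of_nat q - v))))"
    by (simp add: sum_distrib_right mult.assoc)
  also have "\<dots> = (\<Sum>i\<le>q. t q i * b (Suc i)) + (\<Sum>i\<le>q. t q i * f i * b i)"
    by (simp only: b_rec) (simp add: algebra_simps sum.distrib)
  also have "(\<Sum>i\<le>q. t q i * f i * b i) = (\<Sum>i\<le>Suc q. t q i * f i * b i)"
    by (simp add: t_def binomial_eq_0)
  also have "\<dots> = t q 0 * f 0 * b 0 + (\<Sum>i\<le>q. t q (Suc i) * f (Suc i) * b (Suc i))"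
    by (rule sum.atMost_Suc_shift)
  also have "t q 0 * f 0 = t (Suc q) 0"
    by (simp add: t_def f_def pochhammer_Suc mult_ac)
  also have "(\<Sum>i\<le>q. t q i * b (Suc i)) + (t (Suc q) 0 * b 0 + (\<Sum>i\<le>q. t q (Suc i) * f (Suc i) * b (Suc i)))
     = t (Suc q) 0 * b 0 + (\<Sum>i\<le>q. t (Suc q) (Suc i) * b (Suc i))"
    by (simp add: t_rec algebra_simps sum.distrib)
  also have "\<dots> = (\<Sum>i\<le>Suc q. t (Suc q) i * b i)"
    by (rule sum.atMost_Suc_shift [symmetric])
  finally show ?case
    by (simp only: t_def b_def E_def mult_ac)
qed

text \<open>The factors on the left are those of (x)_n, negated and in reverse order.\<close>

lemma pochhammer_reflect:
  fixes x :: "'a :: comm_ring_1"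
  shows "pochhammer (1 - x - of_nat n) n = (-1) ^ n * pochhammer x n"
proof -
  have "1 - x - of_nat n = - (x + of_nat n - 1)" "x = (x + of_nat n - 1) - of_nat n + 1"
    by simp_all
  then show ?thesis
    using pochhammer_minus[of "x + of_nat n - 1" n] by metis
qed

text \<open>Reflection turns (C - u)_q into (u + (1 - C - q))_q, to which the binomial theorem for
  Pochhammer symbols applies; reflecting each (1 - C - q)_(q-i) back gives a form without
  denominators.\<close>

lemma chu_vandermonde_pochhammer:
  fixes C u :: "'a :: comm_ring_1"
  shows "pochhammer (C - u) q =
    (\<Sum>i\<le>q. (-1) ^ i * of_nat (q choose i) * pochhammer u i * pochhammer (C + of_nat i) (q - i))"
proof -
  have eq: "pochhammer (C + of_nat i) (q - i) = (-1) ^ (q - i) * pochhammer (1 - C - of_nat q) (q - i)"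
    if "i \<le> q" for i
  proof -
    have "1 - C - of_nat q = 1 - (C + of_nat i) - of_nat (q - i)"
      using that by (simp add: of_nat_diff)
    then have "pochhammer (1 - C - of_nat q) (q - i) = (-1) ^ (q - i) * pochhammer (C + of_nat i) (q - i)"
      by (simp only: pochhammer_reflect)
    then show ?thesis by (simp flip: power_add mult.assoc)
  qed
  have "u + (1 - C - of_nat q) = 1 - (C - u) - of_nat q"
    by simp
  then have "pochhammer (C - u) q = (-1) ^ q * pochhammer (u + (1 - C - of_nat q)) q"
    by (simp only: pochhammer_reflect) (simp flip: power_add mult.assoc)
  also have "\<dots> = (\<Sum>i\<le>q. (-1) ^ q * (of_nat (q choose i) * pochhammer u i * pochhammer (1 - C - of_nat q) (q - i)))"
    by (subst pochhammer_binomial_sum) (simp add: sum_distrib_left)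
  also have "\<dots> = (\<Sum>i\<le>q. (-1) ^ i * of_nat (q choose i) * pochhammer u i * pochhammer (C + of_nat i) (q - i))"
  proof (intro sum.cong refl)
    fix i assume "i \<in> {..q}"
    then have "i \<le> q" by simp
    then have "(-1) ^ q = ((-1) ^ i * (-1) ^ (q - i) :: 'a)"
      by (simp flip: power_add)
    then show "(-1) ^ q * (of_nat (q choose i) * pochhammer u i * pochhammer (1 - C - of_nat q) (q - i)) =
      (-1) ^ i * of_nat (q choose i) * pochhammer u i * pochhammer (C + of_nat i) (q - i)"
      unfolding eq[OF \<open>i \<le> q\<close>] by (simp only: mult_ac)
  qed
  finally show ?thesis .
qed

lemma sum_triangle_shift:
  fixes f :: "nat \<Rightarrow> nat \<Rightarrow> 'a :: comm_monoid_add"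
  shows "(\<Sum>l\<le>N. \<Sum>q\<le>l. f l q) = (\<Sum>q\<le>N. \<Sum>e\<le>N - q. f (q + e) q)"
  by (simp add: sum.Sigma,
      rule sum.reindex_bij_witness[of _ "\<lambda>(q, e). (q + e, q)" "\<lambda>(l, q). (q, l - q)"], auto)

section \<open>The coefficients of the generating function\<close>

lemma chu_vandermonde_div:
  fixes c u :: "'a :: field_char_0"
  assumes "\<And>j. pochhammer c j \<noteq> 0"
  shows "pochhammer (c - u) q / pochhammer c q =
    (\<Sum>i\<le>q. (-1) ^ i * of_nat (q choose i) * pochhammer u i / pochhammer c i)"
proof -
  have "pochhammer (c + of_nat i) (q - i) / pochhammer c q = 1 / pochhammer c i" if "i \<le> q" for i
    using pochhammer_product[OF that, of c] assms[of q] assms[of i] by (auto simp: field_simps)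
  then have *: "(-1) ^ i * of_nat (q choose i) * pochhammer u i * pochhammer (c + of_nat i) (q - i) / pochhammer c q
     = (-1) ^ i * of_nat (q choose i) * pochhammer u i / pochhammer c i" if "i \<le> q" for i
    using that by (metis mult.right_neutral times_divide_eq_right)
  show ?thesis
    unfolding chu_vandermonde_pochhammer[of c u] sum_divide_distrib
    by (intro sum.cong refl *) simp
qed

text \<open>With the binomial split into factorials the sum is a convolution, ready to be
  interchanged with an outer sum over q.\<close>

lemma chu_vandermonde_fact:
  fixes c u :: "'a :: field_char_0"
  assumes "\<And>j. pochhammer c j \<noteq> 0"
  shows "pochhammer (c - u) q / (pochhammer c q * fact q) =
    (\<Sum>i\<le>q. (-1) ^ i * pochhammer u i / (pochhammer c i * fact i * fact (q - i)))"
proof -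
  have "pochhammer (c - u) q / (pochhammer c q * fact q) = pochhammer (c - u) q / pochhammer c q / fact q"
    by simp
  also have "\<dots> = (\<Sum>i\<le>q. (-1) ^ i * pochhammer u i / (pochhammer c i * fact i * fact (q - i)))"
    unfolding chu_vandermonde_div[OF assms] sum_divide_distrib
    by (intro sum.cong refl) (simp add: binomial_fact)
  finally show ?thesis .
qed

text \<open>Coefficientwise form of (1 - t)^(-x) (1 - t)^(-y) = (1 - t)^(-x-y).\<close>

lemma pochhammer_add_fact:
  fixes x y :: "'a :: field_char_0"
  shows "(\<Sum>e\<le>n. pochhammer x (n - e) / fact (n - e) * (pochhammer y e / fact e)) = pochhammer (x + y) n / fact n"
proof -
  have "pochhammer (y + x) n / fact n =
     (\<Sum>e\<le>n. of_nat (n choose e) * pochhammer y e * pochhammer x (n - e) / fact n)"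
    by (simp add: pochhammer_binomial_sum sum_divide_distrib)
  also have "\<dots> = (\<Sum>e\<le>n. pochhammer x (n - e) / fact (n - e) * (pochhammer y e / fact e))"
    by (intro sum.cong refl) (simp add: binomial_fact field_simps)
  finally show ?thesis by (simp add: add_ac)
qed

text \<open>
  The left-hand side is the coefficient of \<open>t\<^sup>N\<close> in \<open>(1 - t) powr (y - \<beta>) * \<^sub>2F\<^sub>1(a + y, c + y; a + c; t)\<close>.
  The Chu-Vandermonde formula expands it in the basis \<open>(a + y)\<^sub>q (a - y)\<^sub>q\<close>, and
  \<open>saalschuetz_pochhammer\<close> changes the base point from \<open>a\<close> to \<open>\<beta>\<close>.
\<close>
lemma dual_hahn_generating_coeff:
  fixes a \<beta> c y :: "'a :: field_char_0"
  assumes nz: "\<And>j. pochhammer (a + c) j \<noteq> 0"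
  shows "(\<Sum>l\<le>N. pochhammer (\<beta> - y) (N - l) / fact (N - l) *
            (pochhammer (a + y) l * pochhammer (c + y) l / (pochhammer (a + c) l * fact l))) =
         (\<Sum>i\<le>N. (-1) ^ i * (pochhammer (\<beta> + y) i * pochhammer (\<beta> - y) i) *
            (pochhammer (a + \<beta> + of_nat i) (N - i) * pochhammer (c + \<beta> + of_nat i) (N - i)) /
            (fact i * fact (N - i) * pochhammer (a + c) N))"
    (is "?lhs = ?rhs")
proof -
  have "?lhs = (\<Sum>l\<le>N. \<Sum>q\<le>l. pochhammer (\<beta> - y) (N - l) / fact (N - l) * pochhammer (a + y) l *
      ((-1) ^ q * pochhammer (a - y) q / (pochhammer (a + c) q * fact q * fact (l - q))))"
  proof (intro sum.cong refl)
    fix l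
    have *: "pochhammer (c + y) l / (pochhammer (a + c) l * fact l) =
      (\<Sum>q\<le>l. (-1) ^ q * pochhammer (a - y) q / (pochhammer (a + c) q * fact q * fact (l - q)))"
      using chu_vandermonde_fact[OF nz, of "a - y" l] by (simp add: algebra_simps)
    show "pochhammer (\<beta> - y) (N - l) / fact (N - l) *
            (pochhammer (a + y) l * pochhammer (c + y) l / (pochhammer (a + c) l * fact l)) =
       (\<Sum>q\<le>l. pochhammer (\<beta> - y) (N - l) / fact (N - l) * pochhammer (a + y) l *
      ((-1) ^ q * pochhammer (a - y) q / (pochhammer (a + c) q * fact q * fact (l - q))))"
      unfolding sum_distrib_left [symmetric] * [symmetric] by simp
  qed
  also have "\<dots> = (\<Sum>q\<le>N. \<Sum>e\<le>N - q. (-1) ^ q * (pochhammer (a + y) q * pochhammer (a - y) q) /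
      (pochhammer (a + c) q * fact q) *
      (pochhammer (\<beta> - y) (N - q - e) / fact (N - q - e) * (pochhammer (a + y + of_nat q) e / fact e)))"
    unfolding sum_triangle_shift
    by (intro sum.cong refl) (simp add: pochhammer_product' field_simps)
  \<comment> \<open>The parameters \<beta> - y and a + y + q add up to a + \<beta> + q, so y
    survives only in the basis products.\<close>
  also have "\<dots> = (\<Sum>q\<le>N. (-1) ^ q * (pochhammer (a + y) q * pochhammer (a - y) q) /
      (pochhammer (a + c) q * fact q) * (pochhammer (a + \<beta> + of_nat q) (N - q) / fact (N - q)))"
    by (simp only: sum_distrib_left [symmetric] pochhammer_add_fact) (simp add: algebra_simps)
  also have "\<dots> = (\<Sum>q\<le>N. \<Sum>i\<le>q. (-1) ^ q * (pochhammer (\<beta> + y) i * pochhammer (\<beta> - y) i) *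
       pochhammer (a + \<beta> + of_nat i) (N - i) * pochhammer (a - \<beta>) (q - i) /
       (pochhammer (a + c) q * fact i * fact (q - i) * fact (N - q)))"
  proof (intro sum.cong refl)
    fix q assume "q \<in> {..N}"
    then have q: "q \<le> N" by simp
    \<comment> \<open>With C = a + \<beta>, u = \<beta> + y and v = \<beta> - y, the differences C -
      u and C - v are a - y and a + y, and C - u - v = a - \<beta> is free of y.\<close>
    have "pochhammer (a + y) q * pochhammer (a - y) q =
      (\<Sum>i\<le>q. of_nat (q choose i) * pochhammer (\<beta> + y) i * pochhammer (\<beta> - y) i *
           pochhammer (a + \<beta> + of_nat i) (q - i) * pochhammer (a - \<beta>) (q - i))"
      using saalschuetz_pochhammer[of "a + \<beta>" "\<beta> + y" q "\<beta> - y"] by (simp add: algebra_simps)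
    then have "(-1) ^ q * (pochhammer (a + y) q * pochhammer (a - y) q) /
      (pochhammer (a + c) q * fact q) * (pochhammer (a + \<beta> + of_nat q) (N - q) / fact (N - q)) =
      (\<Sum>i\<le>q. (-1) ^ q * (of_nat (q choose i) * pochhammer (\<beta> + y) i * pochhammer (\<beta> - y) i *
           pochhammer (a + \<beta> + of_nat i) (q - i) * pochhammer (a - \<beta>) (q - i)) /
      (pochhammer (a + c) q * fact q) * (pochhammer (a + \<beta> + of_nat q) (N - q) / fact (N - q)))"
      by (simp add: sum_distrib_left sum_divide_distrib sum_distrib_right)
    also have "\<dots> = (\<Sum>i\<le>q. (-1) ^ q * (pochhammer (\<beta> + y) i * pochhammer (\<beta> - y) i) *
       pochhammer (a + \<beta> + of_nat i) (N - i) * pochhammer (a - \<beta>) (q - i) /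
       (pochhammer (a + c) q * fact i * fact (q - i) * fact (N - q)))"
    proof (intro sum.cong refl)
      fix i assume "i \<in> {..q}"
      then have i: "i \<le> q" by simp
      have "pochhammer (a + \<beta> + of_nat i) (N - i) =
          pochhammer (a + \<beta> + of_nat i) (q - i) * pochhammer (a + \<beta> + of_nat q) (N - q)"
        using pochhammer_product[of "q - i" "N - i" "a + \<beta> + of_nat i"] q i by (simp add: of_nat_diff add_ac)
      then show "(-1) ^ q * (of_nat (q choose i) * pochhammer (\<beta> + y) i * pochhammer (\<beta> - y) i *
           pochhammer (a + \<beta> + of_nat i) (q - i) * pochhammer (a - \<beta>) (q - i)) /
      (pochhammer (a + c) q * fact q) * (pochhammer (a + \<beta> + of_nat q) (N - q) / fact (N - q)) =
        (-1) ^ q * (pochhammer (\<beta> + y) i * pochhammer (\<beta> - y) i) *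
       pochhammer (a + \<beta> + of_nat i) (N - i) * pochhammer (a - \<beta>) (q - i) /
       (pochhammer (a + c) q * fact i * fact (q - i) * fact (N - q))"
        using i by (simp add: binomial_fact mult_ac)
    qed
    finally show "(-1) ^ q * (pochhammer (a + y) q * pochhammer (a - y) q) /
      (pochhammer (a + c) q * fact q) * (pochhammer (a + \<beta> + of_nat q) (N - q) / fact (N - q)) = \<dots>" .
  qed
  also have "\<dots> = (\<Sum>i\<le>N. \<Sum>e\<le>N - i. (-1) ^ i * (pochhammer (\<beta> + y) i * pochhammer (\<beta> - y) i) *
       pochhammer (a + \<beta> + of_nat i) (N - i) / (pochhammer (a + c) i * fact i) *
       ((-1) ^ e * pochhammer (a - \<beta>) e / (pochhammer (a + c + of_nat i) e * fact e * fact (N - i - e))))"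
    unfolding sum_triangle_shift
    by (intro sum.cong refl) (simp add: pochhammer_product' power_add mult_ac)
  \<comment> \<open>The sum over e is Chu-Vandermonde with lower parameter a + c + i and upper
    parameter a - \<beta>; their difference c + \<beta> + i restores the symmetry between a and
    c.\<close>
  also have "\<dots> = ?rhs"
  proof (intro sum.cong refl)
    fix i assume "i \<in> {..N}"
    then have i: "i \<le> N" by simp
    have nz': "pochhammer (a + c + of_nat i) j \<noteq> 0" for j
      using nz[of "i + j"] by (simp add: pochhammer_product')
    have 1: "pochhammer (a + c) N = pochhammer (a + c) i * pochhammer (a + c + of_nat i) (N - i)"
      by (rule pochhammer_product[OF i])
    have 2: "a + c + of_nat i - (a - \<beta>) = c + \<beta> + of_nat i"
      by simp
    show "(\<Sum>e\<le>N - i. (-1) ^ i * (pochhammer (\<beta> + y) i * pochhammer (\<beta> - y) i) *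
       pochhammer (a + \<beta> + of_nat i) (N - i) / (pochhammer (a + c) i * fact i) *
       ((-1) ^ e * pochhammer (a - \<beta>) e / (pochhammer (a + c + of_nat i) e * fact e * fact (N - i - e)))) =
       (-1) ^ i * (pochhammer (\<beta> + y) i * pochhammer (\<beta> - y) i) *
            (pochhammer (a + \<beta> + of_nat i) (N - i) * pochhammer (c + \<beta> + of_nat i) (N - i)) /
            (fact i * fact (N - i) * pochhammer (a + c) N)"
      unfolding sum_distrib_left [symmetric] chu_vandermonde_fact[OF nz', symmetric] 1 2
      by (simp add: mult_ac)
  qed
  finally show ?thesis .
qed

text \<open>Expanding (d - y)_l in the (b + y)_m and writing (b - y)_l = (b - y)_m (b + m - y)_e
  leaves, for each m, a power of 1 - t times a single 2F1. That is the previous lemma with \<beta> =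
  b + m, and its basis products merge with those already extracted into index M = m + i. The
  remaining sum over m at fixed M is Chu-Vandermonde once more.\<close>

lemma wilson_generating_coeff:
  fixes a b c d y :: "'a :: field_char_0"
  assumes nz: "\<And>j. pochhammer (a + c) j \<noteq> 0" "\<And>j. pochhammer (b + d) j \<noteq> 0"
  shows "(\<Sum>l\<le>n. pochhammer (b - y) (n - l) * pochhammer (d - y) (n - l) / (pochhammer (b + d) (n - l) * fact (n - l)) *
            (pochhammer (a + y) l * pochhammer (c + y) l / (pochhammer (a + c) l * fact l))) =
         (\<Sum>M\<le>n. (-1) ^ M * (pochhammer (b + y) M * pochhammer (b - y) M) *
            (pochhammer (a + b + of_nat M) (n - M) * pochhammer (b + c + of_nat M) (n - M)) *
            pochhammer (of_nat n + a + b + c + d - 1) M /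
            (fact M * fact (n - M) * pochhammer (a + c) n * pochhammer (b + d) M))"
    (is "?lhs = ?rhs")
proof -
  define Q where "Q = (\<lambda>l. pochhammer (a + y) l * pochhammer (c + y) l / (pochhammer (a + c) l * fact l))"
  have "?lhs = (\<Sum>l\<le>n. pochhammer (b - y) l * pochhammer (d - y) l / (pochhammer (b + d) l * fact l) * Q (n - l))"
    by (rule sum.reindex_bij_witness[of _ "\<lambda>l. n - l" "\<lambda>l. n - l"]) (auto simp: Q_def)
  also have "\<dots> = (\<Sum>l\<le>n. \<Sum>m\<le>l. pochhammer (b - y) l * Q (n - l) *
      ((-1) ^ m * pochhammer (b + y) m / (pochhammer (b + d) m * fact m * fact (l - m))))"
  proof (intro sum.cong refl)
    fix l
    have *: "pochhammer (d - y) l / (pochhammer (b + d) l * fact l) =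
      (\<Sum>m\<le>l. (-1) ^ m * pochhammer (b + y) m / (pochhammer (b + d) m * fact m * fact (l - m)))"
      using chu_vandermonde_fact[OF nz(2), of "b + y" l] by (simp add: algebra_simps)
    show "pochhammer (b - y) l * pochhammer (d - y) l / (pochhammer (b + d) l * fact l) * Q (n - l) =
       (\<Sum>m\<le>l. pochhammer (b - y) l * Q (n - l) *
      ((-1) ^ m * pochhammer (b + y) m / (pochhammer (b + d) m * fact m * fact (l - m))))"
      unfolding sum_distrib_left [symmetric] * [symmetric] by simp
  qed
  also have "\<dots> = (\<Sum>m\<le>n. \<Sum>e\<le>n - m. (-1) ^ m * (pochhammer (b + y) m * pochhammer (b - y) m) /
      (pochhammer (b + d) m * fact m) * (pochhammer (b + of_nat m - y) e / fact e * Q (n - m - e)))"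
    unfolding sum_triangle_shift
    by (intro sum.cong refl) (simp add: pochhammer_product' field_simps)
  also have "\<dots> = (\<Sum>m\<le>n. (-1) ^ m * (pochhammer (b + y) m * pochhammer (b - y) m) /
      (pochhammer (b + d) m * fact m) * (\<Sum>e\<le>n - m. pochhammer (b + of_nat m - y) (n - m - e) / fact (n - m - e) * Q e))"
  proof (intro sum.cong refl, unfold sum_distrib_left [symmetric], intro arg_cong2[where f = "(*)"] refl)
    fix m
    show "(\<Sum>e\<le>n - m. pochhammer (b + of_nat m - y) e / fact e * Q (n - m - e)) =
      (\<Sum>e\<le>n - m. pochhammer (b + of_nat m - y) (n - m - e) / fact (n - m - e) * Q e)"
      by (rule sum.reindex_bij_witness[of _ "\<lambda>l. n - m - l" "\<lambda>l. n - m - l"]) (auto simp del: diff_diff_left)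
  qed
  also have "\<dots> = (\<Sum>m\<le>n. \<Sum>i\<le>n - m. (-1) ^ (m + i) * (pochhammer (b + y) (m + i) * pochhammer (b - y) (m + i)) *
      (pochhammer (a + b + of_nat (m + i)) (n - (m + i)) * pochhammer (b + c + of_nat (m + i)) (n - (m + i))) /
      (pochhammer (b + d) m * pochhammer (a + c) (n - m) * fact m * fact i * fact (n - (m + i))))"
  proof (intro sum.cong refl)
    fix m assume "m \<in> {..n}"
    have *: "(\<Sum>e\<le>n - m. pochhammer (b + of_nat m - y) (n - m - e) / fact (n - m - e) * Q e) =
       (\<Sum>i\<le>n - m. (-1) ^ i * (pochhammer (b + of_nat m + y) i * pochhammer (b + of_nat m - y) i) *
            (pochhammer (a + (b + of_nat m) + of_nat i) (n - m - i) * pochhammer (c + (b + of_nat m) + of_nat i) (n - m - i)) /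
            (fact i * fact (n - m - i) * pochhammer (a + c) (n - m)))"
      unfolding Q_def by (rule dual_hahn_generating_coeff[OF nz(1)])
    have 1: "a + (b + of_nat m) + of_nat i = a + b + of_nat (m + i)"
      "c + (b + of_nat m) + of_nat i = b + c + of_nat (m + i)"
      "b + of_nat m + y = b + y + of_nat m" "b + of_nat m - y = b - y + of_nat m" for i
      by simp_all
    show "(-1) ^ m * (pochhammer (b + y) m * pochhammer (b - y) m) / (pochhammer (b + d) m * fact m) *
       (\<Sum>e\<le>n - m. pochhammer (b + of_nat m - y) (n - m - e) / fact (n - m - e) * Q e) =
       (\<Sum>i\<le>n - m. (-1) ^ (m + i) * (pochhammer (b + y) (m + i) * pochhammer (b - y) (m + i)) *
      (pochhammer (a + b + of_nat (m + i)) (n - (m + i)) * pochhammer (b + c + of_nat (m + i)) (n - (m + i))) /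
      (pochhammer (b + d) m * pochhammer (a + c) (n - m) * fact m * fact i * fact (n - (m + i))))"
      unfolding * unfolding 1 sum_distrib_left pochhammer_product'[of "b + y"] pochhammer_product'[of "b - y"]
        power_add diff_diff_left
      by (intro sum.cong refl) (simp add: mult_ac)
  qed
  also have "\<dots> = (\<Sum>M\<le>n. \<Sum>m\<le>M. (-1) ^ M * (pochhammer (b + y) M * pochhammer (b - y) M) *
      (pochhammer (a + b + of_nat M) (n - M) * pochhammer (b + c + of_nat M) (n - M)) /
      (pochhammer (b + d) m * pochhammer (a + c) (n - m) * fact m * fact (M - m) * fact (n - M)))"
    unfolding sum_triangle_shift by simp
  also have "\<dots> = ?rhs"
  proof (intro sum.cong refl)
    fix M assume "M \<in> {..n}"
    then have M: "M \<le> n" by simp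
    \<comment> \<open>Reflection moves (a + c)_(n-m) into the numerator as (1 - a - c - n)_m.
      Subtracting this parameter from b + d produces n + a + b + c + d - 1, the characteristic
      parameter of a Wilson polynomial of degree n.\<close>
    have "1 / (pochhammer (b + d) m * pochhammer (a + c) (n - m) * fact m * fact (M - m)) =
        (-1) ^ m * pochhammer (1 - a - c - of_nat n) m / (pochhammer (b + d) m * fact m * fact (M - m)) /
        pochhammer (a + c) n" if m: "m \<le> M" for m
    proof -
      have "pochhammer (a + c) n = pochhammer (a + c) (n - m) * pochhammer (a + c + of_nat (n - m)) m"
        using pochhammer_product[of "n - m" n "a + c"] m M by simp
      moreover have "pochhammer (a + c + of_nat (n - m)) m = (-1) ^ m * pochhammer (1 - a - c - of_nat n) m"
      proof -
        have "1 - a - c - of_nat n = 1 - (a + c + of_nat (n - m)) - of_nat m"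
          using m M by (simp add: of_nat_diff)
        then show ?thesis
          by (simp only: pochhammer_reflect) (simp flip: power_add mult.assoc)
      qed
      ultimately have *: "(-1) ^ m * pochhammer (1 - a - c - of_nat n) m / pochhammer (a + c) n = 1 / pochhammer (a + c) (n - m)"
        using nz(1)[of n] nz(1)[of "n - m"] by (simp add: field_simps)
      have "1 / (pochhammer (b + d) m * pochhammer (a + c) (n - m) * fact m * fact (M - m)) =
          1 / pochhammer (a + c) (n - m) / (pochhammer (b + d) m * fact m * fact (M - m))"
        by simp
      also have "\<dots> = (-1) ^ m * pochhammer (1 - a - c - of_nat n) m / (pochhammer (b + d) m * fact m * fact (M - m)) /
          pochhammer (a + c) n"
        unfolding * [symmetric] by (simp add: mult_ac)
      finally show ?thesis .
    qed
    then have "(\<Sum>m\<le>M. 1 / (pochhammer (b + d) m * pochhammer (a + c) (n - m) * fact m * fact (M - m))) =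
       (\<Sum>m\<le>M. (-1) ^ m * pochhammer (1 - a - c - of_nat n) m / (pochhammer (b + d) m * fact m * fact (M - m)) /
        pochhammer (a + c) n)"
      by (intro sum.cong refl) simp
    also have "\<dots> = pochhammer (b + d - (1 - a - c - of_nat n)) M / (pochhammer (b + d) M * fact M) / pochhammer (a + c) n"
      unfolding sum_divide_distrib [symmetric] chu_vandermonde_fact[OF nz(2)] ..
    also have "b + d - (1 - a - c - of_nat n) = of_nat n + a + b + c + d - 1"
      by simp
    finally have **: "(\<Sum>m\<le>M. 1 / (pochhammer (b + d) m * pochhammer (a + c) (n - m) * fact m * fact (M - m))) =
       pochhammer (of_nat n + a + b + c + d - 1) M / (pochhammer (b + d) M * fact M) / pochhammer (a + c) n" .
    have "(\<Sum>m\<le>M. (-1) ^ M * (pochhammer (b + y) M * pochhammer (b - y) M) *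
      (pochhammer (a + b + of_nat M) (n - M) * pochhammer (b + c + of_nat M) (n - M)) /
      (pochhammer (b + d) m * pochhammer (a + c) (n - m) * fact m * fact (M - m) * fact (n - M))) =
      (-1) ^ M * (pochhammer (b + y) M * pochhammer (b - y) M) *
      (pochhammer (a + b + of_nat M) (n - M) * pochhammer (b + c + of_nat M) (n - M)) / fact (n - M) *
      (\<Sum>m\<le>M. 1 / (pochhammer (b + d) m * pochhammer (a + c) (n - m) * fact m * fact (M - m)))"
      unfolding sum_distrib_left by (intro sum.cong refl) (simp add: mult_ac)
    then show "(\<Sum>m\<le>M. (-1) ^ M * (pochhammer (b + y) M * pochhammer (b - y) M) *
      (pochhammer (a + b + of_nat M) (n - M) * pochhammer (b + c + of_nat M) (n - M)) /
      (pochhammer (b + d) m * pochhammer (a + c) (n - m) * fact m * fact (M - m) * fact (n - M))) =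
      (-1) ^ M * (pochhammer (b + y) M * pochhammer (b - y) M) *
            (pochhammer (a + b + of_nat M) (n - M) * pochhammer (b + c + of_nat M) (n - M)) *
            pochhammer (of_nat n + a + b + c + d - 1) M /
            (fact M * fact (n - M) * pochhammer (a + c) n * pochhammer (b + d) M)"
      unfolding ** by (simp add: mult_ac)
  qed
  finally show ?thesis .
qed

section \<open>Decay of the Gamma function\<close>

text \<open>Factor by factor: for fixed imaginary part, |z| / Re z decreases as Re z grows.\<close>

lemma norm_pochhammer_ratio_mono:
  fixes z w :: complex
  assumes "Im z = Im w" "0 < Re z" "Re z \<le> Re w"
  shows "pochhammer (Re z) n * norm (pochhammer w n) \<le> norm (pochhammer z n) * pochhammer (Re w) n"
proof -
  have "(Re z + real i) * norm (w + of_nat i) \<le> norm (z + of_nat i) * (Re w + real i)" for i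
  proof (rule power2_le_imp_le)
    define p q y where "p = Re z + real i" and "q = Re w + real i" and "y = Im w"
    have pq: "0 \<le> p" "p \<le> q" using assms by (auto simp: p_def q_def)
    have "p\<^sup>2 * y\<^sup>2 \<le> q\<^sup>2 * y\<^sup>2"
      using pq by (intro mult_right_mono power_mono) auto
    then show "((Re z + real i) * norm (w + of_nat i))\<^sup>2 \<le> (norm (z + of_nat i) * (Re w + real i))\<^sup>2"
      unfolding power_mult_distrib cmod_power2 using assms(1)
      by (simp add: p_def [symmetric] q_def [symmetric] y_def [symmetric]) (simp add: algebra_simps)
    show "0 \<le> norm (z + of_nat i) * (Re w + real i)"
      using assms by simp
  qed
  then have "(\<Prod>i<n. (Re z + real i) * norm (w + of_nat i)) \<le> (\<Prod>i<n. norm (z + of_nat i) * (Re w + real i))"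
    using assms by (intro prod_mono) auto
  then show ?thesis
    by (simp add: pochhammer_prod prod.distrib prod_norm lessThan_atLeast0)
qed

lemma norm_Gamma_series:
  "norm (Gamma_series z n) = fact n * exp (Re z * ln (real n)) / norm (pochhammer z (n + 1))" for z :: complex
  by (simp add: Gamma_series_def norm_divide norm_mult del: pochhammer_Suc)

lemma norm_pochhammer_ge:
  fixes z :: complex
  assumes "0 < Re z"
  shows "pochhammer (Re z) n \<le> norm (pochhammer z n)"
proof -
  have "(\<Prod>i<n. Re z + real i) \<le> (\<Prod>i<n. norm (z + of_nat i))"
    using assms by (intro prod_mono conjI) (auto intro: order.trans[OF _ complex_Re_le_cmod])
  then show ?thesis
    by (simp add: pochhammer_prod prod_norm lessThan_atLeast0)
qed

lemma pochhammer_neq_0: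
  fixes z :: complex
  assumes "0 < Re z"
  shows "pochhammer z n \<noteq> 0"
  using norm_pochhammer_ge[OF assms, of n] pochhammer_pos[OF assms, of n] by auto

lemma not_nonpos_Int_Re_pos:
  assumes "0 < Re z"
  shows "z \<notin> \<int>\<^sub>\<le>\<^sub>0"
  using assms by (auto elim!: nonpos_Ints_cases)

lemma Gamma_neq_0: "0 < Re z \<Longrightarrow> Gamma z \<noteq> 0" for z :: complex
  by (simp add: Gamma_eq_zero_iff not_nonpos_Int_Re_pos)

lemma norm_Gamma_le:
  fixes z :: complex
  assumes "0 < Re z"
  shows "norm (Gamma z) \<le> Gamma (Re z)"
proof (rule LIMSEQ_le)
  show "(\<lambda>n. norm (Gamma_series z n)) \<longlonglongrightarrow> norm (Gamma z)"
    by (intro tendsto_intros)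
  show "Gamma_series (Re z) \<longlonglongrightarrow> Gamma (Re z)"
    by (rule Gamma_series_LIMSEQ)
  show "\<exists>N. \<forall>n\<ge>N. norm (Gamma_series z n) \<le> Gamma_series (Re z) n"
    unfolding norm_Gamma_series unfolding Gamma_series_def
    using assms norm_pochhammer_ge[OF assms] pochhammer_pos[OF assms]
    by (auto intro!: exI[of _ 0] divide_left_mono mult_pos_pos simp del: pochhammer_Suc
             dest: pochhammer_neq_0[OF assms, THEN notE])
qed

text \<open>Pochhammer symbols stand in the denominator of Euler's product, so the monotonicity is
  reversed: |Gamma z| / Gamma(Re z) increases with Re z on a horizontal line. A decay bound on one
  vertical line therefore passes to everything on its left.\<close>

lemma norm_Gamma_ratio_mono:
  fixes z w :: complex
  assumes "Im z = Im w" "0 < Re z" "Re z \<le> Re w"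
  shows "norm (Gamma z) * Gamma (Re w) \<le> Gamma (Re z) * norm (Gamma w)"
proof (rule LIMSEQ_le)
  show "(\<lambda>n. norm (Gamma_series z n) * Gamma_series (Re w) n) \<longlonglongrightarrow> norm (Gamma z) * Gamma (Re w)"
    by (intro tendsto_intros)
  show "(\<lambda>n. Gamma_series (Re z) n * norm (Gamma_series w n)) \<longlonglongrightarrow> Gamma (Re z) * norm (Gamma w)"
    by (intro tendsto_intros)
  have w: "0 < Re w" using assms by simp
  have "norm (Gamma_series z n) * Gamma_series (Re w) n \<le> Gamma_series (Re z) n * norm (Gamma_series w n)" for n
  proof -
    define K where "K = (fact n * exp (Re z * ln (real n))) * (fact n * exp (Re w * ln (real n)))"
    have "K / (norm (pochhammer z (n + 1)) * pochhammer (Re w) (n + 1)) \<le>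
        K / (pochhammer (Re z) (n + 1) * norm (pochhammer w (n + 1)))"
      using norm_pochhammer_ratio_mono[OF assms, of "n + 1"] pochhammer_pos[OF assms(2)] pochhammer_pos[OF w]
        pochhammer_neq_0[OF assms(2)] pochhammer_neq_0[OF w]
      by (intro divide_left_mono mult_pos_pos) (auto simp: K_def simp del: pochhammer_Suc)
    then show ?thesis
      unfolding norm_Gamma_series unfolding Gamma_series_def K_def
      by (simp del: pochhammer_Suc add: mult_ac)
  qed
  then show "\<exists>N. \<forall>n\<ge>N. norm (Gamma_series z n) * Gamma_series (Re w) n \<le> Gamma_series (Re z) n * norm (Gamma_series w n)"
    by blast
qed

text \<open>
  By the preceding monotonicity, decay on the lines \<open>Re z = 1/2 + m\<close> gives decay in vertical strips.
  On \<open>Re z = 1/2\<close> the reflection formula provides the modulus exactly.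
\<close>
lemma norm_Gamma_half_le: "norm (Gamma (Complex (1/2) y)) \<le> sqrt (2 * pi) * exp (- (pi / 2) * \<bar>y\<bar>)"
proof (rule power2_le_imp_le)
  define z where "z = Complex (1/2) y"
  have "1 - z = cnj z"
    by (simp add: z_def complex_eq_iff)
  then have "Gamma z * cnj (Gamma z) = of_real pi / sin (of_real pi * z)"
    using Gamma_reflection_complex[of z] by (simp add: cnj_Gamma)
  moreover have "sin (of_real pi * z) = of_real (cosh (pi * y))"
  proof -
    have "of_real pi * z = of_real pi / 2 + \<i> * of_real (pi * y)"
      by (simp add: z_def complex_eq_iff)
    then have "sin (of_real pi * z) = cos (\<i> * of_real (pi * y))"
      by (simp add: sin_add del: of_real_mult)
    then show ?thesis
      by (simp only: cosh_conv_cos [symmetric] cosh_field_def exp_minus exp_of_real [symmetric]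
            of_real_divide of_real_add of_real_inverse of_real_numeral)
  qed
  ultimately have "of_real ((norm (Gamma z))\<^sup>2) = complex_of_real (pi / cosh (pi * y))"
    by (simp only: complex_norm_square of_real_divide)
  then have "(norm (Gamma z))\<^sup>2 = pi / cosh (pi * y)"
    using of_real_eq_iff by blast
  also have "\<dots> \<le> pi / (exp (pi * \<bar>y\<bar>) / 2)"
  proof (intro divide_left_mono)
    show "exp (pi * \<bar>y\<bar>) / 2 \<le> cosh (pi * y)"
      by (cases "y \<ge> 0") (simp_all add: cosh_field_def)
  qed (auto simp: cosh_real_pos)
  also have "\<dots> = (sqrt (2 * pi) * exp (- (pi / 2) * \<bar>y\<bar>))\<^sup>2"
    by (simp add: power_mult_distrib exp_minus field_simps flip: exp_double)
  finally show "(norm (Gamma (Complex (1/2) y)))\<^sup>2 \<le> (sqrt (2 * pi) * exp (- (pi / 2) * \<bar>y\<bar>))\<^sup>2"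
    by (simp add: z_def)
qed auto

text \<open>Each use of Gamma(z + 1) = z Gamma(z) costs a linear factor, which an arbitrarily small
  loss in the rate absorbs. This is why the rate is strictly below \<pi>/2 and varies in the
  induction.\<close>

lemma Gamma_half_plus_nat_decay:
  assumes "\<phi> < pi / 2"
  shows "\<exists>C. \<forall>y. norm (Gamma (Complex (1/2 + real m) y)) \<le> C * exp (- \<phi> * \<bar>y\<bar>)"
  using assms
proof (induction m arbitrary: \<phi>)
  case 0
  have "\<phi> * \<bar>y\<bar> \<le> (pi / 2) * \<bar>y\<bar>" for y
    using 0 by (intro mult_right_mono) auto
  then have "norm (Gamma (Complex (1/2) y)) \<le> sqrt (2 * pi) * exp (- \<phi> * \<bar>y\<bar>)" for y
    by (intro order.trans[OF norm_Gamma_half_le] mult_left_mono) auto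
  then show ?case by auto
next
  case (Suc m)
  obtain \<phi>' where \<phi>': "\<phi> < \<phi>'" "\<phi>' < pi / 2"
    using dense Suc.prems by blast
  obtain C where C: "norm (Gamma (Complex (1/2 + real m) y)) \<le> C * exp (- \<phi>' * \<bar>y\<bar>)" for y
    using Suc.IH[OF \<phi>'(2)] by blast
  define \<delta> where "\<delta> = \<phi>' - \<phi>"
  have \<delta>: "\<delta> > 0" using \<phi>' by (simp add: \<delta>_def)
  have C0: "0 \<le> C * exp (- \<phi>' * \<bar>y\<bar>)" for y
    using C[of y] norm_ge_zero order.trans by blast
  have "norm (Gamma (Complex (1/2 + real (Suc m)) y)) \<le> (1/2 + real m + 1 / \<delta>) * C * exp (- \<phi> * \<bar>y\<bar>)" for y
  proof -
    define z where "z = Complex (1/2 + real m) y"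
    have "Complex (1/2 + real (Suc m)) y = z + 1"
      by (simp add: z_def complex_eq_iff)
    then have "norm (Gamma (Complex (1/2 + real (Suc m)) y)) = norm z * norm (Gamma z)"
      using Gamma_plus1[of z] not_nonpos_Int_Re_pos[of z] by (simp add: z_def norm_mult)
    also have "norm z \<le> 1/2 + real m + \<bar>y\<bar>"
      using cmod_le[of z] by (simp add: z_def)
    also have "\<dots> \<le> (1/2 + real m + 1 / \<delta>) * exp (\<delta> * \<bar>y\<bar>)"
    proof -
      have "\<delta> * \<bar>y\<bar> \<le> exp (\<delta> * \<bar>y\<bar>)"
        using exp_ge_add_one_self[of "\<delta> * \<bar>y\<bar>"] by linarith
      then have "\<bar>y\<bar> \<le> 1 / \<delta> * exp (\<delta> * \<bar>y\<bar>)"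
        using \<delta> by (simp add: field_simps)
      moreover have "(1/2 + real m) * 1 \<le> (1/2 + real m) * exp (\<delta> * \<bar>y\<bar>)"
        using \<delta> by (intro mult_left_mono) auto
      ultimately show ?thesis by (simp add: distrib_right)
    qed
    also have "(1/2 + real m + 1 / \<delta>) * exp (\<delta> * \<bar>y\<bar>) * norm (Gamma z) \<le>
        (1/2 + real m + 1 / \<delta>) * exp (\<delta> * \<bar>y\<bar>) * (C * exp (- \<phi>' * \<bar>y\<bar>))"
      using C[of y] \<delta> by (intro mult_left_mono) (auto simp: z_def)
    also have "\<dots> = (1/2 + real m + 1 / \<delta>) * C * exp (- \<phi> * \<bar>y\<bar>)"
    proof -
      have "\<delta> * \<bar>y\<bar> + - \<phi>' * \<bar>y\<bar> = - \<phi> * \<bar>y\<bar>"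
        by (simp add: \<delta>_def algebra_simps)
      then have "exp (\<delta> * \<bar>y\<bar>) * exp (- \<phi>' * \<bar>y\<bar>) = exp (- \<phi> * \<bar>y\<bar>)"
        by (simp only: exp_add [symmetric])
      then show ?thesis by (metis mult.assoc mult.commute)
    qed
    finally show ?thesis by (simp add: mult_right_mono)
  qed
  then show ?case by blast
qed

text \<open>The strip is compared with a line Re z = M on its right; the remaining factor Gamma(Re
  z) is bounded on the compact interval of real parts.\<close>

lemma Gamma_strip_decay:
  assumes "\<phi> < pi / 2" "0 < \<sigma>"
  shows "\<exists>C>0. \<forall>z. \<sigma> \<le> Re z \<longrightarrow> Re z \<le> \<tau> \<longrightarrow> norm (Gamma z) \<le> C * exp (- \<phi> * \<bar>Im z\<bar>)"
proof -
  obtain m :: nat where m: "\<tau> \<le> real m"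
    using real_arch_simple by blast
  define M where "M = 1/2 + real m"
  obtain C where C: "norm (Gamma (Complex M y)) \<le> C * exp (- \<phi> * \<bar>y\<bar>)" for y
    using Gamma_half_plus_nat_decay[OF assms(1), of m] unfolding M_def by blast
  have "compact (Gamma ` {\<sigma>..\<tau>})"
    using assms(2) by (intro compact_continuous_image continuous_on_Gamma) (auto elim!: nonpos_Ints_cases)
  then obtain B where B: "\<And>x. \<sigma> \<le> x \<Longrightarrow> x \<le> \<tau> \<Longrightarrow> norm (Gamma x) \<le> B" "B > 0"
    using compact_imp_bounded bounded_pos by (metis (no_types, lifting) atLeastAtMost_iff imageI)
  have M0: "Gamma M > 0" by (simp add: M_def)
  have "0 \<le> C * exp (- \<phi> * \<bar>0\<bar>)"
    using C[of 0] norm_ge_zero order.trans by blast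
  then have C0: "0 \<le> C" by simp
  have "norm (Gamma z) \<le> (B / Gamma M * (C + 1)) * exp (- \<phi> * \<bar>Im z\<bar>)" if "\<sigma> \<le> Re z" "Re z \<le> \<tau>" for z
  proof -
    have "norm (Gamma z) * Gamma M \<le> Gamma (Re z) * norm (Gamma (Complex M (Im z)))"
      using norm_Gamma_ratio_mono[of z "Complex M (Im z)"] that assms m by (simp add: M_def)
    also have "\<dots> \<le> B * (C * exp (- \<phi> * \<bar>Im z\<bar>))"
      using B(1)[OF that] B(2) C[of "Im z"] by (intro mult_mono) auto
    \<comment> \<open>So far C is only nonnegative; C + 1 makes the final constant positive.\<close>
    also have "\<dots> \<le> B * ((C + 1) * exp (- \<phi> * \<bar>Im z\<bar>))"
      using B(2) by (intro mult_left_mono mult_right_mono) auto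
    finally show ?thesis
      using M0 by (simp add: field_simps)
  qed
  moreover have "B / Gamma M * (C + 1) > 0"
    using B(2) M0 C0 by simp
  ultimately show ?thesis by blast
qed

text \<open>Even in s, and holomorphic for |Re s| < Re a.\<close>

definition gamma_pair :: "complex \<Rightarrow> complex \<Rightarrow> complex" where
  "gamma_pair a s = Gamma (a + s) * Gamma (a - s)"

lemma gamma_pair_strip_decay:
  assumes "\<phi> < pi" "0 < r" "r < Re a"
  shows "\<exists>C>0. \<forall>s. \<bar>Re s\<bar> \<le> r \<longrightarrow> norm (gamma_pair a s) \<le> C * exp (- \<phi> * \<bar>Im s\<bar>)"
proof -
  \<comment> \<open>Each Gamma factor supplies half the rate. Adding |Im (a + s)| and |Im (a - s)|
    by the triangle inequality requires a nonnegative rate, while \<phi> may be negative; hence the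
    maximum with 0.\<close>
  have "max 0 (\<phi> / 2) < pi / 2" using assms pi_gt_zero by (simp add: max_def)
  then obtain C where C: "C > 0" "\<And>z. Re a - r \<le> Re z \<Longrightarrow> Re z \<le> Re a + r \<Longrightarrow>
      norm (Gamma z) \<le> C * exp (- max 0 (\<phi> / 2) * \<bar>Im z\<bar>)"
    using Gamma_strip_decay[of "max 0 (\<phi> / 2)" "Re a - r" "Re a + r"] assms by auto
  define \<psi> where "\<psi> = max 0 (\<phi> / 2)"
  have \<psi>: "\<psi> \<ge> 0" "2 * \<psi> \<ge> \<phi>" by (auto simp: \<psi>_def)
  have "norm (gamma_pair a s) \<le> C\<^sup>2 * exp (- \<phi> * \<bar>Im s\<bar>)" if "\<bar>Re s\<bar> \<le> r" for s
  proof -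
    have "norm (gamma_pair a s) \<le> (C * exp (- \<psi> * \<bar>Im (a + s)\<bar>)) * (C * exp (- \<psi> * \<bar>Im (a - s)\<bar>))"
      unfolding gamma_pair_def norm_mult \<psi>_def using that C(1)
      by (intro mult_mono C(2)) auto
    also have "\<dots> = C\<^sup>2 * exp (- \<psi> * (\<bar>Im (a + s)\<bar> + \<bar>Im (a - s)\<bar>))"
      by (simp add: power2_eq_square ring_distribs flip: exp_add)
    also have "\<dots> \<le> C\<^sup>2 * exp (- \<phi> * \<bar>Im s\<bar>)"
    proof (intro mult_left_mono, unfold exp_le_cancel_iff)
      have "\<phi> * \<bar>Im s\<bar> \<le> 2 * \<psi> * \<bar>Im s\<bar>"
        using \<psi> by (intro mult_right_mono) auto
      also have "\<dots> \<le> \<psi> * (\<bar>Im (a + s)\<bar> + \<bar>Im (a - s)\<bar>)"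
        unfolding mult.assoc [symmetric] mult.commute[of 2] using \<psi>(1)
        by (subst mult.assoc, intro mult_left_mono) auto
      finally show "- \<psi> * (\<bar>Im (a + s)\<bar> + \<bar>Im (a - s)\<bar>) \<le> - \<phi> * \<bar>Im s\<bar>"
        by simp
    qed simp
    finally show ?thesis .
  qed
  moreover have "C\<^sup>2 > 0" using C(1) by simp
  ultimately show ?thesis by blast
qed

lemma gamma_pair_line_decay:
  assumes "\<phi> < pi" "0 < Re a"
  shows "\<exists>C>0. \<forall>x::real. norm (gamma_pair a (\<i> * of_real x)) \<le> C * exp (- \<phi> * \<bar>x\<bar>)"
proof -
  obtain C where C: "C > 0" "\<And>s. \<bar>Re s\<bar> \<le> Re a / 2 \<Longrightarrow> norm (gamma_pair a s) \<le> C * exp (- \<phi> * \<bar>Im s\<bar>)"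
    using gamma_pair_strip_decay[of \<phi> "Re a / 2" a] assms by auto
  have "norm (gamma_pair a (\<i> * of_real x)) \<le> C * exp (- \<phi> * \<bar>x\<bar>)" for x :: real
    using C(2)[of "\<i> * of_real x"] assms(2) by simp
  with \<open>C > 0\<close> show ?thesis by blast
qed

text \<open>For s = ix this is 1/|Gamma(2ix)|^2. Written with \<open>rGamma\<close> it is entire and
  vanishes at s = 0 without any convention about division.\<close>

definition wilson_kernel :: "complex \<Rightarrow> complex" where
  "wilson_kernel s = rGamma (2 * s) * rGamma (- 2 * s)"

lemma wilson_kernel_eq: "wilson_kernel s = - 2 * s * sin (2 * of_real pi * s) / of_real pi"
proof -
  have "rGamma (- 2 * s) = - 2 * s * rGamma (1 - 2 * s)"
    using rGamma_plus1[of "- 2 * s"] by (simp add: add_ac)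
  then have "wilson_kernel s = - 2 * s * (rGamma (2 * s) * rGamma (1 - 2 * s))"
    by (simp add: wilson_kernel_def)
  also have "rGamma (2 * s) * rGamma (1 - 2 * s) = sin (of_real pi * (2 * s)) / of_real pi"
    by (rule rGamma_reflection_complex)
  finally show ?thesis by (simp add: mult_ac)
qed

lemma norm_sin_le_exp: "norm (sin z) \<le> exp \<bar>Im z\<bar>" for z :: complex
proof -
  have "norm (sin z) = norm (exp (\<i> * z) - exp (- (\<i> * z))) / 2"
    by (simp add: sin_exp_eq norm_divide norm_mult)
  also have "\<dots> \<le> (norm (exp (\<i> * z)) + norm (exp (- (\<i> * z)))) / 2"
    by (intro divide_right_mono norm_triangle_ineq4) auto
  also have "\<dots> \<le> (exp \<bar>Im z\<bar> + exp \<bar>Im z\<bar>) / 2"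
    by (intro divide_right_mono add_mono) auto
  finally show ?thesis by simp
qed

text \<open>The sine grows like exp(2\<pi>|x|); the excess of \<phi> over 2\<pi> absorbs the linear
  factor 2s.\<close>

lemma wilson_kernel_growth:
  assumes "2 * pi < \<phi>"
  shows "\<exists>C>0. \<forall>x::real. norm (wilson_kernel (\<i> * of_real x)) \<le> C * exp (\<phi> * \<bar>x\<bar>)"
proof -
  define \<delta> where "\<delta> = \<phi> - 2 * pi"
  have \<delta>: "\<delta> > 0" using assms by (simp add: \<delta>_def)
  have "norm (wilson_kernel (\<i> * of_real x)) \<le> 2 / (\<delta> * pi) * exp (\<phi> * \<bar>x\<bar>)" for x :: real
  proof -
    have "norm (wilson_kernel (\<i> * of_real x)) = 2 * \<bar>x\<bar> * norm (sin (2 * of_real pi * (\<i> * of_real x))) / pi"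
      by (simp add: wilson_kernel_eq norm_divide norm_mult)
    also have "\<dots> \<le> 2 * \<bar>x\<bar> * exp (2 * pi * \<bar>x\<bar>) / pi"
      using norm_sin_le_exp[of "2 * of_real pi * (\<i> * of_real x)"]
      by (intro divide_right_mono mult_left_mono) (auto simp: abs_mult)
    also have "\<dots> \<le> 2 * (1 / \<delta> * exp (\<delta> * \<bar>x\<bar>)) * exp (2 * pi * \<bar>x\<bar>) / pi"
    proof -
      have "\<delta> * \<bar>x\<bar> \<le> exp (\<delta> * \<bar>x\<bar>)"
        using exp_ge_add_one_self[of "\<delta> * \<bar>x\<bar>"] by linarith
      then have "\<bar>x\<bar> \<le> 1 / \<delta> * exp (\<delta> * \<bar>x\<bar>)"
        using \<delta> by (simp add: field_simps)
      then show ?thesis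
        by (intro divide_right_mono mult_right_mono mult_left_mono) auto
    qed
    also have "\<dots> = 2 / (\<delta> * pi) * exp (\<delta> * \<bar>x\<bar> + 2 * pi * \<bar>x\<bar>)"
      by (simp add: exp_add)
    also have "\<delta> * \<bar>x\<bar> + 2 * pi * \<bar>x\<bar> = \<phi> * \<bar>x\<bar>"
      by (simp add: \<delta>_def algebra_simps)
    finally show ?thesis .
  qed
  moreover have "2 / (\<delta> * pi) > 0" using \<delta> by simp
  ultimately show ?thesis by blast
qed

lemma integrable_exp_neg_abs:
  assumes "0 < \<phi>"
  shows "integrable lborel (\<lambda>x::real. exp (- \<phi> * \<bar>x\<bar>))"
proof -
  have "set_integrable lborel {0..} (\<lambda>x::real. exp (- \<phi> * x))"
  proof -
    have "(\<lambda>x::real. exp (- \<phi> * x)) absolutely_integrable_on {0..}"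
      using integrable_on_exp_minus_to_infinity[OF assms, of 0]
      by (intro nonnegative_absolutely_integrable_1) auto
    then show ?thesis
      unfolding set_integrable_def by (subst (asm) integrable_completion) auto
  qed
  then have f: "integrable lborel (\<lambda>x::real. indicator {0..} x *\<^sub>R exp (- \<phi> * x))"
    by (simp add: set_integrable_def)
  from lborel_integrable_real_affine[OF f, of "-1" 0]
  have g: "integrable lborel (\<lambda>x::real. indicator {0..} (- x) *\<^sub>R exp (- \<phi> * (- x)))"
    by simp
  show ?thesis
    by (rule Bochner_Integration.integrable_bound[OF Bochner_Integration.integrable_add[OF f g]])
       (auto simp: indicator_def abs_if)
qed

section \<open>The functional equation of the de Branges-Wilson integral\<close>

lemma integral_real_line_FTC:
  fixes h H :: "real \<Rightarrow> complex"
  assumes int: "integrable lborel h" and cont: "continuous_on UNIV h"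
    and deriv: "\<And>x. (H has_vector_derivative h x) (at x)"
    and lim: "(\<lambda>n. H (real n) - H (- real n)) \<longlonglongrightarrow> L"
  shows "(LBINT x. h x) = L"
proof -
  have "(\<lambda>n. LBINT x. indicator {- real n..real n} x *\<^sub>R h x) \<longlonglongrightarrow> (LBINT x. h x)"
  proof (rule integral_dominated_convergence)
    show "integrable lborel (\<lambda>x. norm (h x))" using int by simp
    show "h \<in> borel_measurable lborel" using int by simp
    then show "(\<lambda>x. indicator {- real n..real n} x *\<^sub>R h x) \<in> borel_measurable lborel" for n
      by simp
    show "AE x in lborel. (\<lambda>n. indicator {- real n..real n} x *\<^sub>R h x) \<longlonglongrightarrow> h x"
    proof (intro AE_I2 tendsto_eventually)
      fix x :: real
      obtain N :: nat where N: "\<bar>x\<bar> \<le> real N" using real_arch_simple by blast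
      show "eventually (\<lambda>n. indicator {- real n..real n} x *\<^sub>R h x = h x) sequentially"
        using eventually_ge_at_top[of N] by eventually_elim (use N in \<open>auto simp: indicator_def abs_le_iff\<close>)
    qed
  qed (auto simp: indicator_def)
  moreover have "(LBINT x. indicator {- real n..real n} x *\<^sub>R h x) = H (real n) - H (- real n)" for n
    by (intro integral_FTC_Icc continuous_on_subset[OF cont] has_vector_derivative_at_within[OF deriv]) auto
  ultimately show ?thesis
    using lim LIMSEQ_unique by simp
qed

text \<open>A contour shift without contour integrals. On the convex strip f has a primitive F, and
  (F(ix + 1/2) - F(ix - 1/2)) / i is an antiderivative of the integrand. By the mean value estimate
  on the horizontal segment of length 1 it decays like f itself, so its boundary values at both ends
  are 0.\<close>

lemma integral_strip_shift:
  fixes f :: "complex \<Rightarrow> complex"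
  assumes holo: "f holomorphic_on {s. \<bar>Re s\<bar> < r}" and r: "1/2 < r" and \<psi>: "0 < \<psi>"
    and bound: "\<And>s. \<bar>Re s\<bar> \<le> 1/2 \<Longrightarrow> norm (f s) \<le> C * exp (- \<psi> * \<bar>Im s\<bar>)"
  shows "(LBINT x. f (\<i> * of_real x + 1/2) - f (\<i> * of_real x - 1/2)) = 0"
proof -
  define S where "S = {s::complex. \<bar>Re s\<bar> < r}"
  have S_eq: "S = {s. Re s < r} \<inter> {s. Re s > - r}" by (auto simp: S_def)
  have opn: "open S" unfolding S_eq by (intro open_Int open_halfspace_Re_gt open_halfspace_Re_lt)
  have "convex S" unfolding S_eq by (intro convex_Int convex_halfspace_Re_gt convex_halfspace_Re_lt)
  with opn obtain F where "\<And>s. s \<in> S \<Longrightarrow> (F has_field_derivative f s) (at s within S)"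
    using holomorphic_convex_primitive'[of S f] holo unfolding S_def by blast
  then have F: "\<And>s. s \<in> S \<Longrightarrow> (F has_field_derivative f s) (at s)"
    using opn by (metis at_within_open)
  have cont: "continuous_on S f"
    using holo by (simp add: S_def holomorphic_on_imp_continuous_on)
  define h where "h = (\<lambda>x::real. f (\<i> * of_real x + 1/2) - f (\<i> * of_real x - 1/2))"
  define H where "H = (\<lambda>x::real. (F (\<i> * of_real x + 1/2) - F (\<i> * of_real x - 1/2)) / \<i>)"
  have conth: "continuous_on A h" for A
    unfolding h_def using r
    by (intro continuous_intros continuous_on_compose2[OF cont]) (auto simp: S_def)
  have derivF: "((\<lambda>x::real. F (\<i> * of_real x + p)) has_vector_derivative f (\<i> * of_real x + p) * \<i>) (at x within A)"
    if "\<bar>Re p\<bar> \<le> 1/2" for p x A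
  proof -
    have 1: "((\<lambda>x::real. \<i> * of_real x + p) has_vector_derivative \<i>) (at x within A)"
      by (auto intro!: derivative_eq_intros simp: has_vector_derivative_def scaleR_conv_of_real mult.commute)
    have 2: "(F has_field_derivative f (\<i> * of_real x + p)) (at (\<i> * of_real x + p) within (\<lambda>x. \<i> * of_real x + p) ` A)"
      using that r by (intro has_field_derivative_at_within[OF F]) (auto simp: S_def)
    from field_vector_diff_chain_within[OF 1 2] show ?thesis
      by (simp only: o_def mult.commute)
  qed
  have derivH: "(H has_vector_derivative h x) (at x within A)" for x A
  proof -
    have "((\<lambda>x::real. F (\<i> * of_real x + 1/2) - F (\<i> * of_real x + - (1/2))) has_vector_derivative
        f (\<i> * of_real x + 1/2) * \<i> - f (\<i> * of_real x + - (1/2)) * \<i>) (at x within A)"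
      by (intro has_vector_derivative_diff derivF) auto
    from has_vector_derivative_divide[OF this, of \<i>] show ?thesis
      unfolding H_def h_def
      by (simp only: left_diff_distrib [symmetric] nonzero_mult_div_cancel_right[OF complex_i_not_zero] add_uminus_conv_diff)
  qed
  have Hbound: "norm (H x) \<le> C * exp (- \<psi> * \<bar>x\<bar>)" for x
  proof -
    have "norm (F (\<i> * of_real x + 1/2) - F (\<i> * of_real x - 1/2)) \<le>
        C * exp (- \<psi> * \<bar>x\<bar>) * norm ((\<i> * of_real x + 1/2) - (\<i> * of_real x - 1/2))"
    proof (rule field_differentiable_bound)
      let ?L = "{s. Re s \<le> 1/2} \<inter> {s. Re s \<ge> -1/2} \<inter> {s. Im s = x}"
      show "convex ?L"
        by (intro convex_Int convex_halfspace_Re_le convex_halfspace_Re_ge)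
           (auto simp: convex_def algebra_simps, metis distrib_right mult_1)
      fix s assume s: "s \<in> ?L"
      then show "(F has_field_derivative f s) (at s within ?L)"
        using r by (intro has_field_derivative_at_within[OF F]) (auto simp: S_def)
      show "norm (f s) \<le> C * exp (- \<psi> * \<bar>x\<bar>)"
        using bound[of s] s by auto
    qed auto
    then show ?thesis by (simp add: H_def norm_divide norm_mult)
  qed
  have hbound: "norm (h x) \<le> 2 * C * exp (- \<psi> * \<bar>x\<bar>)" for x
  proof -
    have "norm (h x) \<le> norm (f (\<i> * of_real x + 1/2)) + norm (f (\<i> * of_real x - 1/2))"
      unfolding h_def by (rule norm_triangle_ineq4)
    also have "\<dots> \<le> C * exp (- \<psi> * \<bar>x\<bar>) + C * exp (- \<psi> * \<bar>x\<bar>)"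
      using bound[of "\<i> * of_real x + 1/2"] bound[of "\<i> * of_real x - 1/2"] by (intro add_mono) auto
    finally show ?thesis by simp
  qed
  have "(LBINT x. h x) = 0 - 0"
  proof (rule integral_real_line_FTC[OF _ conth derivH])
    have [measurable]: "h \<in> borel_measurable lborel"
      using borel_measurable_continuous_onI[OF conth[of UNIV]] by simp
    show "integrable lborel h"
    proof (rule Bochner_Integration.integrable_bound)
      show "integrable lborel (\<lambda>x. 2 * C * exp (- \<psi> * \<bar>x\<bar>))"
        by (intro integrable_mult_right integrable_exp_neg_abs \<psi>)
      show "AE x in lborel. norm (h x) \<le> norm (2 * C * exp (- \<psi> * \<bar>x\<bar>))"
        using order.trans[OF hbound abs_ge_self] by (intro AE_I2) simp
    qed simp
    have lim: "(\<lambda>n. C * exp (- \<psi> * real n)) \<longlonglongrightarrow> 0"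
      using \<psi> by real_asymp
    show "(\<lambda>n. H (real n) - H (- real n)) \<longlonglongrightarrow> 0 - 0"
    proof (intro tendsto_diff)
      show "(\<lambda>n. H (real n)) \<longlonglongrightarrow> 0"
        using Hbound[of "real _"] by (intro Lim_null_comparison[OF always_eventually lim]) auto
      show "(\<lambda>n. H (- real n)) \<longlonglongrightarrow> 0"
        using Hbound[of "- real _"] by (intro Lim_null_comparison[OF always_eventually lim]) auto
    qed
  qed
  then show ?thesis by (simp add: h_def)
qed

lemma gamma_pair_plus1:
  assumes "\<bar>Re s\<bar> < Re a"
  shows "gamma_pair (a + 1) s = (a + s) * (a - s) * gamma_pair a s"
proof -
  have "Gamma (a + s + 1) = (a + s) * Gamma (a + s)" "Gamma (a - s + 1) = (a - s) * Gamma (a - s)"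
    using assms by (auto intro!: Gamma_plus1 not_nonpos_Int_Re_pos)
  moreover have "a + 1 + s = a + s + 1" "a + 1 - s = a - s + 1"
    by simp_all
  ultimately show ?thesis by (simp only: gamma_pair_def mult_ac)
qed

text \<open>A half-shift of both parameter and argument leaves one Gamma factor unchanged and raises
  the other by 1. The values on the two edges of the strip thus become multiples of the same
  unshifted pair.\<close>

lemma gamma_pair_shift_half:
  assumes "\<bar>Re s\<bar> < Re a"
  shows "gamma_pair (a + 1/2) (s + 1/2) = (a + s) * gamma_pair a s"
    and "gamma_pair (a + 1/2) (s - 1/2) = (a - s) * gamma_pair a s"
proof -
  have 1: "Gamma (a + s + 1) = (a + s) * Gamma (a + s)" "Gamma (a - s + 1) = (a - s) * Gamma (a - s)"
    using assms by (auto intro!: Gamma_plus1 not_nonpos_Int_Re_pos)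
  have 2: "a + 1/2 + (s + 1/2) = a + s + 1" "a + 1/2 - (s + 1/2) = a - s"
     "a + 1/2 + (s - 1/2) = a + s" "a + 1/2 - (s - 1/2) = a - s + 1"
    by (simp_all add: field_simps)
  show "gamma_pair (a + 1/2) (s + 1/2) = (a + s) * gamma_pair a s"
    "gamma_pair (a + 1/2) (s - 1/2) = (a - s) * gamma_pair a s"
    unfolding gamma_pair_def 2 1 by simp_all
qed

text \<open>At s = ix, under conjugation symmetry of the parameters, this is the orthogonality
  weight of the Wilson polynomials.\<close>

definition wilson_weight :: "complex \<Rightarrow> complex \<Rightarrow> complex \<Rightarrow> complex \<Rightarrow> complex \<Rightarrow> complex" where
  "wilson_weight a b c d s = gamma_pair a s * gamma_pair b s * gamma_pair c s * gamma_pair d s * wilson_kernel s"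

text \<open>Taken over the whole line, twice the half-line integral of an even weight; hence 4\<pi>
  instead of 2\<pi> in \<open>wilson_value\<close>.\<close>

definition wilson_integral :: "complex \<Rightarrow> complex \<Rightarrow> complex \<Rightarrow> complex \<Rightarrow> complex" where
  "wilson_integral a b c d = (LBINT x. wilson_weight a b c d (\<i> * of_real x))"

lemma exp_bound_mult:
  fixes f g :: "real \<Rightarrow> complex"
  assumes "\<exists>C>0. \<forall>x. norm (f x) \<le> C * exp (\<phi> * \<bar>x\<bar>)" "\<exists>C>0. \<forall>x. norm (g x) \<le> C * exp (\<psi> * \<bar>x\<bar>)"
  shows "\<exists>C>0. \<forall>x. norm (f x * g x) \<le> C * exp ((\<phi> + \<psi>) * \<bar>x\<bar>)"
proof -
  obtain A B where A: "A > 0" "\<And>x. norm (f x) \<le> A * exp (\<phi> * \<bar>x\<bar>)"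
    and B: "B > 0" "\<And>x. norm (g x) \<le> B * exp (\<psi> * \<bar>x\<bar>)"
    using assms by blast
  have "norm (f x * g x) \<le> A * B * exp ((\<phi> + \<psi>) * \<bar>x\<bar>)" for x
  proof -
    have "norm (f x * g x) \<le> (A * exp (\<phi> * \<bar>x\<bar>)) * (B * exp (\<psi> * \<bar>x\<bar>))"
      unfolding norm_mult using A B by (intro mult_mono mult_nonneg_nonneg) (simp_all add: less_imp_le)
    then show ?thesis
      unfolding distrib_right exp_add by (simp only: mult_ac)
  qed
  then show ?thesis
    using A(1) B(1) by (intro exI[of _ "A * B"]) simp
qed

text \<open>Three pairs against the kernel still leave a rate near 3\<pi> - 2\<pi> = \<pi>. This
  controls the integrand that remains when a tends to infinity and its pair is normalised
  away.\<close>

lemma gamma_triple_decay: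
  assumes "\<psi> < pi" "0 < Re a" "0 < Re b" "0 < Re c"
  shows "\<exists>C>0. \<forall>x::real. norm (gamma_pair a (\<i> * of_real x) * gamma_pair b (\<i> * of_real x) *
    gamma_pair c (\<i> * of_real x) * wilson_kernel (\<i> * of_real x)) \<le> C * exp (- \<psi> * \<bar>x\<bar>)"
proof -
  define \<epsilon> where "\<epsilon> = (pi - \<psi>) / 4"
  have \<epsilon>: "\<epsilon> > 0" using assms(1) by (simp add: \<epsilon>_def)
  then have 1: "pi - \<epsilon> < pi" "2 * pi < 2 * pi + \<epsilon>" by simp_all
  have 2: "- (pi - \<epsilon>) + - (pi - \<epsilon>) + - (pi - \<epsilon>) + (2 * pi + \<epsilon>) = - \<psi>"
    by (simp add: \<epsilon>_def field_simps)
  show ?thesis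
    unfolding 2 [symmetric]
    by (intro exp_bound_mult gamma_pair_line_decay wilson_kernel_growth assms 1)
qed

lemma wilson_weight_decay:
  assumes "\<psi> < 2 * pi" "0 < Re a" "0 < Re b" "0 < Re c" "0 < Re d"
  shows "\<exists>C>0. \<forall>x::real. norm (wilson_weight a b c d (\<i> * of_real x)) \<le> C * exp (- \<psi> * \<bar>x\<bar>)"
proof -
  \<comment> \<open>The slack is shared equally among five factors: four pairs and the
    kernel.\<close>
  define \<epsilon> where "\<epsilon> = (2 * pi - \<psi>) / 5"
  have \<epsilon>: "\<epsilon> > 0" using assms(1) by (simp add: \<epsilon>_def)
  then have 1: "pi - \<epsilon> < pi" "2 * pi < 2 * pi + \<epsilon>" by simp_all
  have 2: "- (pi - \<epsilon>) + - (pi - \<epsilon>) + - (pi - \<epsilon>) + - (pi - \<epsilon>) + (2 * pi + \<epsilon>) = - \<psi>"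
    by (simp add: \<epsilon>_def field_simps)
  show ?thesis
    unfolding wilson_weight_def 2 [symmetric]
    by (intro exp_bound_mult gamma_pair_line_decay wilson_kernel_growth assms 1)
qed

lemma continuous_on_wilson_kernel: "continuous_on A (\<lambda>x::real. wilson_kernel (\<i> * of_real x))"
  unfolding wilson_kernel_eq by (intro continuous_intros) auto

lemma continuous_on_gamma_pair:
  assumes "0 < Re a"
  shows "continuous_on A (\<lambda>x::real. gamma_pair a (\<i> * of_real x))"
proof -
  have "continuous_on {z::complex. Re z > 0} Gamma"
    by (intro continuous_on_Gamma) (auto dest: not_nonpos_Int_Re_pos)
  note * = continuous_on_compose2[OF this]
  show ?thesis
    unfolding gamma_pair_def using assms by (intro continuous_on_mult *) (auto intro!: continuous_intros)
qed

lemma borel_measurable_wilson_kernel [measurable]: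
  "(\<lambda>x::real. wilson_kernel (\<i> * of_real x)) \<in> borel_measurable borel"
  by (intro borel_measurable_continuous_onI continuous_on_wilson_kernel)

lemma borel_measurable_gamma_pair:
  "0 < Re a \<Longrightarrow> (\<lambda>x::real. gamma_pair a (\<i> * of_real x)) \<in> borel_measurable borel"
  by (intro borel_measurable_continuous_onI continuous_on_gamma_pair)

lemma borel_measurable_wilson_weight:
  assumes "0 < Re a" "0 < Re b" "0 < Re c" "0 < Re d"
  shows "(\<lambda>x::real. wilson_weight a b c d (\<i> * of_real x)) \<in> borel_measurable borel"
  unfolding wilson_weight_def
  by (intro borel_measurable_times borel_measurable_gamma_pair borel_measurable_wilson_kernel assms)

text \<open>The exponential leaves room for the growth of the hypergeometric factors when sum and
  integral are exchanged.\<close>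

lemma integrable_exp_wilson_weight:
  assumes "\<theta> < 2 * pi" "0 < Re a" "0 < Re b" "0 < Re c" "0 < Re d"
  shows "integrable lborel (\<lambda>x::real. exp (\<theta> * \<bar>x\<bar>) * norm (wilson_weight a b c d (\<i> * of_real x)))"
proof -
  obtain \<psi> where \<psi>: "\<theta> < \<psi>" "\<psi> < 2 * pi" using dense[OF assms(1)] by blast
  obtain C where C: "C > 0" "\<And>x::real. norm (wilson_weight a b c d (\<i> * of_real x)) \<le> C * exp (- \<psi> * \<bar>x\<bar>)"
    using wilson_weight_decay[OF \<psi>(2) assms(2-)] by blast
  have [measurable]: "(\<lambda>x::real. wilson_weight a b c d (\<i> * of_real x)) \<in> borel_measurable borel"
    by (intro borel_measurable_wilson_weight assms)
  show ?thesis
  proof (rule Bochner_Integration.integrable_bound)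
    show "integrable lborel (\<lambda>x. C * exp (- (\<psi> - \<theta>) * \<bar>x\<bar>))"
      using \<psi> by (intro integrable_mult_right integrable_exp_neg_abs) auto
    have "exp (\<theta> * \<bar>x\<bar>) * norm (wilson_weight a b c d (\<i> * of_real x)) \<le> C * exp (- (\<psi> - \<theta>) * \<bar>x\<bar>)" for x :: real
    proof -
      have "exp (\<theta> * \<bar>x\<bar>) * norm (wilson_weight a b c d (\<i> * of_real x)) \<le> exp (\<theta> * \<bar>x\<bar>) * (C * exp (- \<psi> * \<bar>x\<bar>))"
        using C by (intro mult_left_mono) auto
      also have "\<dots> = C * exp (\<theta> * \<bar>x\<bar> + - \<psi> * \<bar>x\<bar>)"
        unfolding exp_add by (simp only: mult_ac)
      also have "\<theta> * \<bar>x\<bar> + - \<psi> * \<bar>x\<bar> = - (\<psi> - \<theta>) * \<bar>x\<bar>"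
        by (simp add: algebra_simps)
      finally show ?thesis .
    qed
    then show "AE x in lborel. norm (exp (\<theta> * \<bar>x\<bar>) * norm (wilson_weight a b c d (\<i> * of_real x))) \<le> norm (C * exp (- (\<psi> - \<theta>) * \<bar>x\<bar>))"
      using C(1) by (intro AE_I2) (simp add: abs_mult)
  qed simp
qed

lemma integrable_wilson_weight:
  assumes "0 < Re a" "0 < Re b" "0 < Re c" "0 < Re d"
  shows "integrable lborel (\<lambda>x::real. wilson_weight a b c d (\<i> * of_real x))"
proof -
  have [measurable]: "(\<lambda>x::real. wilson_weight a b c d (\<i> * of_real x)) \<in> borel_measurable borel"
    by (intro borel_measurable_wilson_weight assms)
  show ?thesis
    by (subst integrable_norm_iff [symmetric])
       (use integrable_exp_wilson_weight[of 0, OF _ assms] in auto)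
qed

lemma wilson_weight_plus1:
  assumes "0 < Re a"
  shows "wilson_weight (a + 1) b c d (\<i> * of_real x) =
    (a + \<i> * of_real x) * (a - \<i> * of_real x) * wilson_weight a b c d (\<i> * of_real x)"
  using assms by (simp add: wilson_weight_def gamma_pair_plus1)

text \<open>Both half-shifts negate sin(2\<pi>s) and turn the product of pairs into the unshifted
  one times the product of all a_j + s or all a_j - s. Their difference is odd in s and so supplies
  the factor s that the kernel contains.\<close>

lemma wilson_integral_plus1:
  assumes "0 < Re a" "0 < Re b" "0 < Re c" "0 < Re d"
  shows "(a + b + c + d) * wilson_integral (a + 1) b c d = (a + b) * (a + c) * (a + d) * wilson_integral a b c d"
proof -
  define f where "f = (\<lambda>s. sin (2 * of_real pi * s) * gamma_pair (a + 1/2) s * gamma_pair (b + 1/2) s *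
     gamma_pair (c + 1/2) s * gamma_pair (d + 1/2) s)"
  \<comment> \<open>All poles of the shifted pairs satisfy |Re s| >= 1/2 + m, so f is holomorphic
    beyond both lines Re s = 1/2 and Re s = -1/2.\<close>
  define m where "m = min (min (Re a) (Re b)) (min (Re c) (Re d))"
  have m: "m > 0" using assms by (simp add: m_def)
  \<comment> \<open>Four pairs at rate 3\<pi>/4 beat the growth 2\<pi> of the sine by \<pi>.\<close>
  have \<phi>: "3/4 * pi < pi" by simp
  obtain A where A: "A > 0" "\<And>s. \<bar>Re s\<bar> \<le> 1/2 \<Longrightarrow> norm (gamma_pair (a + 1/2) s) \<le> A * exp (- (3/4 * pi) * \<bar>Im s\<bar>)"
    using gamma_pair_strip_decay[OF \<phi>, of "1/2" "a + 1/2"] assms by auto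
  obtain B where B: "B > 0" "\<And>s. \<bar>Re s\<bar> \<le> 1/2 \<Longrightarrow> norm (gamma_pair (b + 1/2) s) \<le> B * exp (- (3/4 * pi) * \<bar>Im s\<bar>)"
    using gamma_pair_strip_decay[OF \<phi>, of "1/2" "b + 1/2"] assms by auto
  obtain C where C: "C > 0" "\<And>s. \<bar>Re s\<bar> \<le> 1/2 \<Longrightarrow> norm (gamma_pair (c + 1/2) s) \<le> C * exp (- (3/4 * pi) * \<bar>Im s\<bar>)"
    using gamma_pair_strip_decay[OF \<phi>, of "1/2" "c + 1/2"] assms by auto
  obtain D where D: "D > 0" "\<And>s. \<bar>Re s\<bar> \<le> 1/2 \<Longrightarrow> norm (gamma_pair (d + 1/2) s) \<le> D * exp (- (3/4 * pi) * \<bar>Im s\<bar>)"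
    using gamma_pair_strip_decay[OF \<phi>, of "1/2" "d + 1/2"] assms by auto
  have "(LBINT x. f (\<i> * of_real x + 1/2) - f (\<i> * of_real x - 1/2)) = 0"
  proof (rule integral_strip_shift)
    show "f holomorphic_on {s. \<bar>Re s\<bar> < 1/2 + m}"
      unfolding f_def gamma_pair_def
      by (intro holomorphic_intros not_nonpos_Int_Re_pos) (auto simp: m_def)
    show "1/2 < 1/2 + m" using m by simp
    show "0 < pi" by simp
    fix s :: complex assume s: "\<bar>Re s\<bar> \<le> 1/2"
    define t where "t = \<bar>Im s\<bar>"
    have "norm (f s) \<le> exp (2 * pi * t) * (A * exp (- (3/4 * pi) * t)) * (B * exp (- (3/4 * pi) * t)) *
        (C * exp (- (3/4 * pi) * t)) * (D * exp (- (3/4 * pi) * t))"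
      unfolding f_def norm_mult t_def
      using A(2)[OF s] B(2)[OF s] C(2)[OF s] D(2)[OF s] norm_sin_le_exp[of "2 * of_real pi * s"] A(1) B(1) C(1) D(1)
      by (intro mult_mono mult_nonneg_nonneg norm_ge_zero) (simp_all add: abs_mult)
    also have "\<dots> = A * B * C * D * exp (2 * pi * t + (- (3/4 * pi) * t) + (- (3/4 * pi) * t) + (- (3/4 * pi) * t) + (- (3/4 * pi) * t))"
      unfolding exp_add by (simp only: mult_ac)
    also have "2 * pi * t + (- (3/4 * pi) * t) + (- (3/4 * pi) * t) + (- (3/4 * pi) * t) + (- (3/4 * pi) * t) = - pi * t"
      by (simp add: field_simps)
    finally show "norm (f s) \<le> A * B * C * D * exp (- pi * \<bar>Im s\<bar>)"
      by (simp add: t_def)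
  qed
  \<comment> \<open>The difference is \<open>\<pi> (e\<^sub>3 + e\<^sub>1 s\<^sup>2)\<close> times the weight, the odd part of \<open>(a + s)(b + s)(c + s)(d + s)\<close>
     being \<open>s (e\<^sub>3 + e\<^sub>1 s\<^sup>2)\<close>; moreover \<open>e\<^sub>3 + e\<^sub>1 a\<^sup>2 = (a + b)(a + c)(a + d)\<close>.\<close>
  also have "(\<lambda>x::real. f (\<i> * of_real x + 1/2) - f (\<i> * of_real x - 1/2)) =
     (\<lambda>x. of_real pi * ((a + b) * (a + c) * (a + d) * wilson_weight a b c d (\<i> * of_real x) -
                        (a + b + c + d) * wilson_weight (a + 1) b c d (\<i> * of_real x)))"
  proof
    fix x :: real
    define s where "s = \<i> * complex_of_real x"
    have s: "Re s = 0" by (simp add: s_def)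
    define P where "P = gamma_pair a s * gamma_pair b s * gamma_pair c s * gamma_pair d s"
    define S where "S = sin (2 * of_real pi * s)"
    have "2 * of_real pi * (s + 1/2) = 2 * of_real pi * s + of_real pi"
      "2 * of_real pi * (s - 1/2) = 2 * of_real pi * s - of_real pi"
      by (simp_all add: field_simps)
    then have sin: "sin (2 * of_real pi * (s + 1/2)) = - S" "sin (2 * of_real pi * (s - 1/2)) = - S"
      by (simp_all add: S_def sin_add sin_diff)
    have f1: "f (s + 1/2) = - S * P * ((a + s) * (b + s) * (c + s) * (d + s))"
      unfolding f_def sin using assms s by (simp add: gamma_pair_shift_half P_def mult_ac)
    have f2: "f (s - 1/2) = - S * P * ((a - s) * (b - s) * (c - s) * (d - s))"
      unfolding f_def sin using assms s by (simp add: gamma_pair_shift_half P_def mult_ac)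
    have w: "wilson_weight a b c d s = P * (- 2 * s * S / of_real pi)"
      by (simp add: wilson_weight_def P_def wilson_kernel_eq S_def)
    have w': "wilson_weight (a + 1) b c d s = (a + s) * (a - s) * wilson_weight a b c d s"
      unfolding s_def by (rule wilson_weight_plus1[OF assms(1)])
    show "f (s + 1/2) - f (s - 1/2) = of_real pi * ((a + b) * (a + c) * (a + d) * wilson_weight a b c d s -
                        (a + b + c + d) * wilson_weight (a + 1) b c d s)"
      unfolding f1 f2 w' w by (simp add: field_simps)
  qed
  also have "(LBINT x. of_real pi * ((a + b) * (a + c) * (a + d) * wilson_weight a b c d (\<i> * of_real x) -
                        (a + b + c + d) * wilson_weight (a + 1) b c d (\<i> * of_real x))) =
      of_real pi * ((a + b) * (a + c) * (a + d) * wilson_integral a b c d - (a + b + c + d) * wilson_integral (a + 1) b c d)"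
    using integrable_wilson_weight[OF assms] integrable_wilson_weight[of "a + 1" b c d] assms
    by (simp add: wilson_integral_def)
  finally show ?thesis by simp
qed

section \<open>Evaluation of the de Branges-Wilson integral\<close>

text \<open>Gamma(z + n) ~ (n - 1)! n^z, which is Euler's limit for Gamma(z) rearranged.\<close>

lemma Gamma_shift_asymp:
  fixes z :: complex
  assumes "0 < Re z"
  shows "(\<lambda>n. Gamma (z + of_nat n) / (fact (n - 1) * exp (z * of_real (ln (real n))))) \<longlonglongrightarrow> 1"
proof -
  have "(\<lambda>n. Gamma z / Gamma_series' z n) \<longlonglongrightarrow> Gamma z / Gamma z"
    using assms by (intro tendsto_intros Gamma_series'_LIMSEQ Gamma_neq_0)
  moreover have "Gamma z / Gamma_series' z n = Gamma (z + of_nat n) / (fact (n - 1) * exp (z * of_real (ln (real n))))" for n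
    using assms by (simp add: Gamma_series'_def pochhammer_Gamma not_nonpos_Int_Re_pos Gamma_neq_0)
  ultimately show ?thesis
    using Gamma_neq_0[OF assms] by simp
qed

text \<open>Since n^(a+s) n^(a-s) = (n^a)^2, the dependence on s disappears in the limit.\<close>

lemma gamma_pair_shift_LIMSEQ:
  assumes "0 < Re a"
  shows "(\<lambda>n. gamma_pair (a + of_nat n) (\<i> * of_real x) / (Gamma (a + of_nat n))\<^sup>2) \<longlonglongrightarrow> 1"
proof -
  define r where "r = (\<lambda>z n. Gamma (z + of_nat n) / (fact (n - 1) * exp (z * of_real (ln (real n)))) :: complex)"
  define s where "s = \<i> * complex_of_real x"
  have "(\<lambda>n. r (a + s) n * r (a - s) n / (r a n)\<^sup>2) \<longlonglongrightarrow> 1 * 1 / 1\<^sup>2"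
    unfolding r_def using assms by (intro tendsto_intros Gamma_shift_asymp) (auto simp: s_def)
  moreover have "r (a + s) n * r (a - s) n / (r a n)\<^sup>2 = gamma_pair (a + of_nat n) s / (Gamma (a + of_nat n))\<^sup>2" for n
  proof -
    define L where "L = complex_of_real (ln (real n))"
    have "exp ((a + s) * L) * exp ((a - s) * L) = (exp (a * L))\<^sup>2"
      by (simp add: power2_eq_square algebra_simps flip: exp_add)
    moreover have "a + of_nat n + s = a + s + of_nat n" "a + of_nat n - s = a - s + of_nat n"
      by simp_all
    ultimately show ?thesis
      by (simp add: r_def gamma_pair_def L_def [symmetric] power2_eq_square field_simps)
  qed
  ultimately show ?thesis by (simp add: s_def)
qed

text \<open>The bound |Gamma z| <= Gamma(Re z) removes x. What remains is the square of Gamma(Re a +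
  n) / |Gamma(a + n)|; the two asymptotic normalisations have equal modulus, so this converges and
  is bounded.\<close>

lemma gamma_pair_shift_bounded:
  assumes "0 < Re a"
  shows "\<exists>B>0. \<forall>n. \<forall>x::real. norm (gamma_pair (a + of_nat n) (\<i> * of_real x) / (Gamma (a + of_nat n))\<^sup>2) \<le> B"
proof -
  define r where "r = (\<lambda>z n. Gamma (z + of_nat n) / (fact (n - 1) * exp (z * of_real (ln (real n)))) :: complex)"
  define q where "q = (\<lambda>n. (r (of_real (Re a)) n / of_real (norm (r a n)))\<^sup>2)"
  have "q \<longlonglongrightarrow> (1 / of_real (norm (1 :: complex)))\<^sup>2"
    unfolding q_def r_def using assms by (intro tendsto_intros Gamma_shift_asymp) auto
  then have "Bseq q"
    by (intro convergent_imp_Bseq) (auto simp: convergent_def)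
  then obtain B where B: "B > 0" "\<And>n. norm (q n) \<le> B"
    using BseqE by blast
  have "norm (gamma_pair (a + of_nat n) (\<i> * of_real x) / (Gamma (a + of_nat n))\<^sup>2) \<le> B" for n x
  proof -
    define L where "L = complex_of_real (ln (real n))"
    have "norm (gamma_pair (a + of_nat n) (\<i> * of_real x)) \<le> Gamma (Re a + real n) * Gamma (Re a + real n)"
      unfolding gamma_pair_def norm_mult
      using norm_Gamma_le[of "a + of_nat n + \<i> * of_real x"] norm_Gamma_le[of "a + of_nat n - \<i> * of_real x"] assms
      by (intro mult_mono) auto
    then have "norm (gamma_pair (a + of_nat n) (\<i> * of_real x) / (Gamma (a + of_nat n))\<^sup>2) \<le>
        (Gamma (Re a + real n) / norm (Gamma (a + of_nat n)))\<^sup>2"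
      by (simp add: norm_divide norm_mult power_divide divide_right_mono power2_eq_square)
    also have "Gamma (Re a + real n) / norm (Gamma (a + of_nat n)) = norm (r (of_real (Re a)) n / of_real (norm (r a n)))"
    proof -
      have "Gamma (of_real (Re a) + of_nat n :: complex) = of_real (Gamma (Re a + real n))"
        by (simp flip: Gamma_complex_of_real)
      then show ?thesis
        using assms by (simp add: r_def norm_divide norm_mult)
    qed
    also have "\<dots>\<^sup>2 = norm (q n)"
      by (simp only: q_def norm_power)
    also have "\<dots> \<le> B" by (rule B)
    finally show ?thesis .
  qed
  with B(1) show ?thesis by blast
qed

definition wilson_value :: "complex \<Rightarrow> complex \<Rightarrow> complex \<Rightarrow> complex \<Rightarrow> complex" where
  "wilson_value a b c d = 4 * of_real pi *
     (Gamma (a + b) * Gamma (a + c) * Gamma (a + d) * Gamma (b + c) * Gamma (b + d) * Gamma (c + d)) /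
     Gamma (a + b + c + d)"

lemma wilson_value_neq_0:
  assumes "0 < Re a" "0 < Re b" "0 < Re c" "0 < Re d"
  shows "wilson_value a b c d \<noteq> 0"
  using assms by (simp add: wilson_value_def Gamma_neq_0)

lemma wilson_value_plus1:
  assumes "0 < Re a" "0 < Re b" "0 < Re c" "0 < Re d"
  shows "(a + b + c + d) * wilson_value (a + 1) b c d = (a + b) * (a + c) * (a + d) * wilson_value a b c d"
proof -
  have eq: "Gamma (a + 1 + z) = (a + z) * Gamma (a + z)" if "0 < Re z" for z
    using Gamma_plus1[of "a + z"] not_nonpos_Int_Re_pos[of "a + z"] that assms by (simp add: algebra_simps)
  define S where "S = a + (b + c + d)"
  have sums: "a + 1 + b + c + d = a + 1 + (b + c + d)" "a + b + c + d = S"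
    by (simp_all add: S_def)
  have "Gamma (a + 1 + (b + c + d)) = S * Gamma S"
    unfolding S_def using assms by (intro eq) auto
  moreover have "S \<noteq> 0"
    using assms by (auto simp: S_def complex_eq_iff)
  ultimately show ?thesis
    unfolding wilson_value_def sums using assms by (simp add: eq mult_ac)
qed

lemma wilson_ratio_plus_nat:
  assumes "0 < Re a" "0 < Re b" "0 < Re c" "0 < Re d"
  shows "wilson_integral (a + of_nat n) b c d / wilson_value (a + of_nat n) b c d =
         wilson_integral a b c d / wilson_value a b c d"
proof (induction n)
  case (Suc n)
  define z where "z = a + of_nat n"
  have z: "0 < Re z" using assms by (simp add: z_def)
  have nz: "z + b + c + d \<noteq> 0" "z + b \<noteq> 0" "z + c \<noteq> 0" "z + d \<noteq> 0"
    using assms z by (auto simp: complex_eq_iff)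
  define q where "q = (z + b) * (z + c) * (z + d) / (z + b + c + d)"
  have "q \<noteq> 0"
    using nz by (simp add: q_def)
  moreover have "wilson_integral (z + 1) b c d = q * wilson_integral z b c d"
    "wilson_value (z + 1) b c d = q * wilson_value z b c d"
    using wilson_integral_plus1[OF z assms(2-)] wilson_value_plus1[OF z assms(2-)] nz(1)
    by (simp_all add: q_def eq_divide_eq mult.commute)
  ultimately have "wilson_integral (z + 1) b c d / wilson_value (z + 1) b c d = wilson_integral z b c d / wilson_value z b c d"
    by simp
  then show ?case
    using Suc.IH by (simp add: z_def add_ac)
qed simp

text \<open>The powers of n cancel because (a + b) + (a + c) + (a + d) = (a + b + c + d) + 2a, and
  numerator and denominator both contain three factorials.\<close>

lemma wilson_value_shift_LIMSEQ:
  assumes "0 < Re a" "0 < Re b" "0 < Re c" "0 < Re d"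
  shows "(\<lambda>n. wilson_value (a + of_nat n) b c d / (Gamma (a + of_nat n))\<^sup>2) \<longlonglongrightarrow>
      4 * of_real pi * (Gamma (b + c) * Gamma (b + d) * Gamma (c + d))"
proof -
  define r where "r = (\<lambda>z n. Gamma (z + of_nat n) / (fact (n - 1) * exp (z * of_real (ln (real n)))) :: complex)"
  define K where "K = 4 * of_real pi * (Gamma (b + c) * Gamma (b + d) * Gamma (c + d))"
  have "(\<lambda>n. K * (r (a + b) n * r (a + c) n * r (a + d) n / (r (a + b + c + d) n * (r a n)\<^sup>2))) \<longlonglongrightarrow> K * (1 * 1 * 1 / (1 * 1\<^sup>2))"
    unfolding r_def using assms by (intro tendsto_intros Gamma_shift_asymp) auto
  moreover have "K * (r (a + b) n * r (a + c) n * r (a + d) n / (r (a + b + c + d) n * (r a n)\<^sup>2)) =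
      wilson_value (a + of_nat n) b c d / (Gamma (a + of_nat n))\<^sup>2" for n
  proof -
    define L where "L = complex_of_real (ln (real n))"
    have 1: "exp ((a + b) * L) * exp ((a + c) * L) * exp ((a + d) * L) = exp ((a + b + c + d) * L) * (exp (a * L))\<^sup>2"
      by (simp add: power2_eq_square algebra_simps flip: exp_add)
    have 2: "a + of_nat n + b = a + b + of_nat n" "a + of_nat n + c = a + c + of_nat n" "a + of_nat n + d = a + d + of_nat n"
      "a + b + of_nat n + c + d = a + b + c + d + of_nat n"
      by simp_all
    define E1 E2 E3 E4 E5 where "E1 = exp ((a + b) * L)" and "E2 = exp ((a + c) * L)" and "E3 = exp ((a + d) * L)"
      and "E4 = exp ((a + b + c + d) * L)" and "E5 = exp (a * L)"
    have nz: "E1 \<noteq> 0" "E2 \<noteq> 0" "E3 \<noteq> 0" "E4 \<noteq> 0" "E5 \<noteq> 0"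
      by (simp_all add: E1_def E2_def E3_def E4_def E5_def)
    have "E4 * E5\<^sup>2 = E1 * E2 * E3"
      using 1 by (simp add: E1_def E2_def E3_def E4_def E5_def)
    define F where "F = (fact (n - 1) :: complex)"
    have F: "F \<noteq> 0" by (simp add: F_def)
    have cancel: "(G1 / (F * E1)) * (G2 / (F * E2)) * (G3 / (F * E3)) / ((G4 / (F * E4)) * (G5 / (F * E5))\<^sup>2) =
       G1 * G2 * G3 / (G4 * G5\<^sup>2)" for G1 G2 G3 G4 G5
    proof -
      have cancel: "(G1 / (F * E1)) * (G2 / (F * E2)) * (G3 / (F * E3)) / ((G4 / (F * E4)) * (G5 / (F * E5))\<^sup>2) =
        G1 * G2 * G3 / (G4 * G5\<^sup>2) * ((E4 * E5\<^sup>2) / (E1 * E2 * E3))"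
        using F nz by (simp add: divide_simps power2_eq_square)
      also have "(E4 * E5\<^sup>2) / (E1 * E2 * E3) = 1"
        unfolding \<open>E4 * E5\<^sup>2 = E1 * E2 * E3\<close> using nz by simp
      finally show ?thesis by simp
    qed
    show ?thesis
      unfolding r_def L_def [symmetric] E1_def [symmetric] E2_def [symmetric] E3_def [symmetric] E4_def [symmetric] E5_def [symmetric]
        F_def [symmetric] wilson_value_def 2 K_def cancel
      by (simp add: mult_ac)
  qed
  ultimately show ?thesis by (simp add: K_def)
qed

lemma wilson_integral_shift_LIMSEQ:
  assumes "0 < Re a" "0 < Re b" "0 < Re c" "0 < Re d"
  shows "(\<lambda>n. wilson_integral (a + of_nat n) b c d / (Gamma (a + of_nat n))\<^sup>2) \<longlonglongrightarrow>
      (LBINT x. gamma_pair b (\<i> * of_real x) * gamma_pair c (\<i> * of_real x) *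
         gamma_pair d (\<i> * of_real x) * wilson_kernel (\<i> * of_real x))"
proof -
  define J where "J = (\<lambda>x::real. gamma_pair b (\<i> * of_real x) * gamma_pair c (\<i> * of_real x) *
         gamma_pair d (\<i> * of_real x) * wilson_kernel (\<i> * of_real x))"
  define g where "g = (\<lambda>n (x::real). gamma_pair (a + of_nat n) (\<i> * of_real x) / (Gamma (a + of_nat n))\<^sup>2)"
  obtain B where B: "B > 0" "\<And>n x. norm (g n x) \<le> B"
    using gamma_pair_shift_bounded[OF assms(1)] unfolding g_def by blast
  \<comment> \<open>Rate 1 is a convenient choice between 0 and \<pi>.\<close>
  obtain C where C: "C > 0" "\<And>x. norm (J x) \<le> C * exp (- 1 * \<bar>x\<bar>)"
    using gamma_triple_decay[of 1 b c d] assms pi_gt3 unfolding J_def by fastforce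
  have [measurable]: "J \<in> borel_measurable borel"
    unfolding J_def by (intro borel_measurable_times borel_measurable_gamma_pair borel_measurable_wilson_kernel assms)
  have [measurable]: "g n \<in> borel_measurable borel" for n
    unfolding g_def using assms by (intro borel_measurable_divide borel_measurable_gamma_pair) auto
  have "(\<lambda>n. LBINT x. g n x * J x) \<longlonglongrightarrow> (LBINT x. J x)"
  proof (rule integral_dominated_convergence)
    show "integrable lborel (\<lambda>x. B * (C * exp (- 1 * \<bar>x\<bar>)))"
      by (intro integrable_mult_right integrable_exp_neg_abs) auto
    show "AE x in lborel. (\<lambda>n. g n x * J x) \<longlonglongrightarrow> J x"
      using tendsto_mult[OF gamma_pair_shift_LIMSEQ[OF assms(1)] tendsto_const, where b = "J _"] by (simp add: g_def)
    show "AE x in lborel. norm (g n x * J x) \<le> B * (C * exp (- 1 * \<bar>x\<bar>))" for n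
      unfolding norm_mult using B C by (intro AE_I2 mult_mono) (auto simp: less_imp_le)
  qed auto
  moreover have "(LBINT x. g n x * J x) = wilson_integral (a + of_nat n) b c d / (Gamma (a + of_nat n))\<^sup>2" for n
  proof -
    have "g n x * J x = wilson_weight (a + of_nat n) b c d (\<i> * of_real x) / (Gamma (a + of_nat n))\<^sup>2" for x
      by (simp add: g_def J_def wilson_weight_def)
    then show ?thesis
      by (simp add: wilson_integral_def)
  qed
  ultimately show ?thesis by (simp add: J_def)
qed

text \<open>Invariance under a -> a + 1 alone would leave a 1-periodic factor undetermined; the
  limit along a + n excludes it. The integral in L stays unevaluated, since all that matters is that
  a does not occur in it.\<close>

lemma wilson_ratio_first_independent:
  assumes "0 < Re a" "0 < Re a'" "0 < Re b" "0 < Re c" "0 < Re d"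
  shows "wilson_integral a b c d / wilson_value a b c d = wilson_integral a' b c d / wilson_value a' b c d"
proof -
  define L where "L = (LBINT x. gamma_pair b (\<i> * of_real x) * gamma_pair c (\<i> * of_real x) *
         gamma_pair d (\<i> * of_real x) * wilson_kernel (\<i> * of_real x)) / (4 * of_real pi * (Gamma (b + c) * Gamma (b + d) * Gamma (c + d)))"
  have "wilson_integral a b c d / wilson_value a b c d = L" if a: "0 < Re a" for a
  proof -
    have "(\<lambda>n. (wilson_integral (a + of_nat n) b c d / (Gamma (a + of_nat n))\<^sup>2) /
        (wilson_value (a + of_nat n) b c d / (Gamma (a + of_nat n))\<^sup>2)) \<longlonglongrightarrow> L"
      unfolding L_def using a assms
      by (intro tendsto_divide wilson_integral_shift_LIMSEQ wilson_value_shift_LIMSEQ) (auto simp: Gamma_neq_0)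
    moreover have "(wilson_integral (a + of_nat n) b c d / (Gamma (a + of_nat n))\<^sup>2) /
        (wilson_value (a + of_nat n) b c d / (Gamma (a + of_nat n))\<^sup>2) = wilson_integral a b c d / wilson_value a b c d" for n
    proof -
      have "Gamma (a + of_nat n) \<noteq> 0" using a by (intro Gamma_neq_0) auto
      then show ?thesis
        using wilson_ratio_plus_nat[OF a assms(3-)] by simp
    qed
    ultimately show ?thesis
      using LIMSEQ_unique[OF _ tendsto_const] by fastforce
  qed
  then show ?thesis using assms by simp
qed

section \<open>The base case with all parameters 1/2, where the weight is elementary\<close>

lemma gamma_pair_half: "gamma_pair (1/2) (\<i> * of_real x) = of_real (pi / cosh (pi * x))"
proof -
  define z where "z = 1/2 + \<i> * complex_of_real x"
  have "gamma_pair (1/2) (\<i> * of_real x) = Gamma z * Gamma (1 - z)"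
    by (simp add: gamma_pair_def z_def)
  also have "\<dots> = of_real pi / sin (of_real pi * z)"
    by (rule Gamma_reflection_complex)
  also have "of_real pi * z = of_real pi / 2 + \<i> * of_real (pi * x)"
    by (simp add: z_def algebra_simps)
  also have "sin \<dots> = cos (\<i> * of_real (pi * x))"
    by (simp add: sin_add del: of_real_mult)
  also have "\<dots> = of_real (cosh (pi * x))"
    by (simp only: cosh_conv_cos [symmetric] cosh_field_def exp_minus exp_of_real [symmetric]
            of_real_divide of_real_add of_real_inverse of_real_numeral)
  finally show ?thesis by simp
qed

lemma wilson_kernel_imaginary: "wilson_kernel (\<i> * of_real x) = of_real (2 * x * sinh (2 * pi * x) / pi)"
proof -
  have "2 * of_real pi * (\<i> * complex_of_real x) = \<i> * of_real (2 * pi * x)"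
    by simp
  then have "wilson_kernel (\<i> * of_real x) = 2 * of_real x * (- \<i> * sin (\<i> * of_real (2 * pi * x))) / of_real pi"
    unfolding wilson_kernel_eq by (simp only:) (simp del: of_real_mult)
  also have "- \<i> * sin (\<i> * of_real (2 * pi * x)) = of_real (sinh (2 * pi * x))"
    by (simp only: sinh_conv_sin [symmetric] sinh_field_def exp_minus exp_of_real [symmetric]
            of_real_divide of_real_diff of_real_inverse of_real_numeral)
  finally show ?thesis by simp
qed

lemma wilson_integral_half: "wilson_integral (1/2) (1/2) (1/2) (1/2) = 4 * of_real pi"
proof -
  define h where "h = (\<lambda>x::real. wilson_weight (1/2) (1/2) (1/2) (1/2) (\<i> * of_real x))"
  \<comment> \<open>Found by integrating 4 \<pi>^3 x sinh(\<pi>x) / cosh(\<pi>x)^3 by parts: the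
    hyperbolic factor is a multiple of the derivative of cosh(\<pi>x)^(-2), whose own antiderivative
    is a multiple of tanh(\<pi>x).\<close>
  define H where "H = (\<lambda>x::real. 2 * pi * tanh (pi * x) - 2 * pi\<^sup>2 * x / (cosh (pi * x))\<^sup>2)"
  have h_eq: "h x = of_real (4 * pi ^ 3 * x * sinh (pi * x) / cosh (pi * x) ^ 3)" for x
  proof -
    have "h x = of_real ((pi / cosh (pi * x)) ^ 4 * (2 * x * sinh (2 * (pi * x)) / pi))"
      unfolding h_def wilson_weight_def gamma_pair_half wilson_kernel_imaginary
      by (simp add: power4_eq_xxxx mult.assoc)
    also have "(pi / cosh (pi * x)) ^ 4 * (2 * x * sinh (2 * (pi * x)) / pi) = 4 * pi ^ 3 * x * sinh (pi * x) / cosh (pi * x) ^ 3"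
      unfolding sinh_double by (simp add: field_simps power4_eq_xxxx power3_eq_cube)
    finally show ?thesis .
  qed
  have "(LBINT x. h x) = of_real (4 * pi)"
  proof (rule integral_real_line_FTC[where H = "\<lambda>x. of_real (H x)"])
    show "integrable lborel h"
      unfolding h_def by (intro integrable_wilson_weight) auto
    show "continuous_on UNIV h"
      unfolding h_def wilson_weight_def
      by (intro continuous_on_mult continuous_on_gamma_pair continuous_on_wilson_kernel) auto
    fix x :: real
    have cosh: "cosh (pi * x) \<noteq> 0" by (metis cosh_real_pos less_irrefl)
    have "(H has_real_derivative 4 * pi ^ 3 * x * sinh (pi * x) / cosh (pi * x) ^ 3) (at x)"
      unfolding H_def tanh_def using cosh
      by (auto intro!: derivative_eq_intros simp: field_simps power2_eq_square power3_eq_cube)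
         (use hyperbolic_pythagoras[of "pi * x"] in algebra)
    then show "((\<lambda>x. of_real (H x)) has_vector_derivative h x) (at x)"
      unfolding h_eq by (intro has_vector_derivative_of_real) (simp add: has_real_derivative_iff_has_vector_derivative)
  next
    have "(\<lambda>n. H (real n) - H (- real n)) \<longlonglongrightarrow> 4 * pi"
      unfolding H_def tanh_def cosh_field_def sinh_field_def by real_asymp
    then show "(\<lambda>n. complex_of_real (H (real n)) - of_real (H (- real n))) \<longlonglongrightarrow> of_real (4 * pi)"
      by (simp only: of_real_diff [symmetric] tendsto_of_real_iff)
  qed
  then show ?thesis by (simp add: wilson_integral_def h_def)
qed

theorem wilson_integral_eq:
  assumes "0 < Re a" "0 < Re b" "0 < Re c" "0 < Re d"
  shows "wilson_integral a b c d = wilson_value a b c d"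
proof -
  define P where "P = (\<lambda>a b c d. wilson_integral a b c d / wilson_value a b c d)"
  have indep: "P a b c d = P (1/2) b c d" if "0 < Re a" "0 < Re b" "0 < Re c" "0 < Re d" for a b c d
    unfolding P_def using that by (intro wilson_ratio_first_independent) auto
  \<comment> \<open>Cyclic rotation suffices: each parameter in turn comes first and is replaced by
    1/2.\<close>
  have perm: "P a b c d = P b c d a" for a b c d
    by (simp add: P_def wilson_integral_def wilson_value_def wilson_weight_def mult_ac add_ac)
  have "P a b c d = P b c d (1/2)" using indep[of a b c d] perm[of "1/2" b c d] assms by simp
  also have "\<dots> = P c d (1/2) (1/2)" using indep[of b c d "1/2"] perm[of "1/2" c d "1/2"] assms by simp
  also have "\<dots> = P d (1/2) (1/2) (1/2)" using indep[of c d "1/2" "1/2"] perm[of "1/2" d "1/2" "1/2"] assms by simp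
  also have "\<dots> = P (1/2) (1/2) (1/2) (1/2)" using indep[of d "1/2" "1/2" "1/2"] assms by simp
  also have "\<dots> = 1"
  proof -
    have "1/2 + 1/2 + 1/2 + 1/2 = (2 :: complex)" by simp
    moreover have "Gamma (2 :: complex) = 1"
      using Gamma_fact[of 1, where ?'a = complex] by simp
    ultimately have "wilson_value (1/2) (1/2) (1/2) (1/2) = 4 * of_real pi"
      unfolding wilson_value_def by (simp only:) simp
    then show ?thesis
      by (simp add: P_def wilson_integral_half)
  qed
  finally show ?thesis
    using wilson_value_neq_0[OF assms] by (simp add: P_def)
qed

section \<open>Moments of the generating function coefficients\<close>

text \<open>The classical terminating balanced 3F2 at 1. Balance says C - u - v = 1 - W - q, so the
  last Pochhammer symbol of the ring identity reflects into (W + i)_(q-i), which yields the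
  denominators (W)_i.\<close>

lemma saalschuetz_sum:
  fixes C W u v :: "'a :: field_char_0"
  assumes nz: "\<And>j. pochhammer C j \<noteq> 0" "\<And>j. pochhammer W j \<noteq> 0"
    and balanced: "C + W = u + v + 1 - of_nat q"
  shows "(\<Sum>i\<le>q. (-1) ^ i * of_nat (q choose i) * pochhammer u i * pochhammer v i / (pochhammer C i * pochhammer W i)) =
    (-1) ^ q * pochhammer (C - u) q * pochhammer (C - v) q / (pochhammer C q * pochhammer W q)"
proof -
  have eq: "C - u - v = 1 - W - of_nat q"
    using balanced by (simp add: algebra_simps)
  have *: "pochhammer (C - u) q * pochhammer (C - v) q = (\<Sum>i\<le>q. (-1) ^ q * (pochhammer C q * pochhammer W q) *
      ((-1) ^ i * of_nat (q choose i) * pochhammer u i * pochhammer v i / (pochhammer C i * pochhammer W i)))"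
    unfolding saalschuetz_pochhammer[of C u q v]
  proof (intro sum.cong refl)
    fix i assume "i \<in> {..q}"
    then have i: "i \<le> q" by simp
    have "1 - W - of_nat q = 1 - (W + of_nat i) - of_nat (q - i)"
      using i by (simp add: of_nat_diff)
    then have 1: "pochhammer (C - u - v) (q - i) = (-1) ^ (q - i) * pochhammer (W + of_nat i) (q - i)"
      unfolding eq by (simp only: pochhammer_reflect)
    have 2: "pochhammer W q = pochhammer W i * pochhammer (W + of_nat i) (q - i)"
      "pochhammer C q = pochhammer C i * pochhammer (C + of_nat i) (q - i)"
      by (rule pochhammer_product[OF i])+
    have 3: "(-1) ^ (q - i) = ((-1) ^ q * (-1) ^ i :: 'a)"
      using i by (auto simp: minus_one_power_iff)
    show "of_nat (q choose i) * pochhammer u i * pochhammer v i * pochhammer (C + of_nat i) (q - i) * pochhammer (C - u - v) (q - i) =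
      (-1) ^ q * (pochhammer C q * pochhammer W q) *
      ((-1) ^ i * of_nat (q choose i) * pochhammer u i * pochhammer v i / (pochhammer C i * pochhammer W i))"
      unfolding 1 2 3 using nz[of i] by simp
  qed
  show ?thesis
    unfolding mult.assoc[of "(-1) ^ q"] * sum_distrib_left [symmetric]
    using nz[of q] by (simp flip: mult.assoc power_add)
qed

lemma pochhammer_minus_of_nat:
  "pochhammer (- of_nat n) i = ((-1) ^ i * of_nat (n choose i) * fact i :: 'a :: field_char_0)"
proof -
  have "of_nat (n choose i) = (-1) ^ i * pochhammer (- of_nat n) i / (fact i :: 'a)"
    by (simp add: binomial_gbinomial gbinomial_pochhammer)
  then show ?thesis by (simp flip: power_add mult.assoc)
qed

lemma wilson_finite_sum:
  "wilson k x a b c h = pochhammer (a + b) k * pochhammer (a + c) k * pochhammer (a + h) k *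
     (\<Sum>i\<le>k. (-1) ^ i * of_nat (k choose i) * pochhammer (of_nat k + a + b + c + h - 1) i *
        (pochhammer (a + \<i> * x) i * pochhammer (a - \<i> * x) i) /
        (pochhammer (a + b) i * pochhammer (a + c) i * pochhammer (a + h) i))"
proof -
  have "hypergeo [- of_nat k, of_nat k + a + b + c + h - 1, a + \<i> * x, a - \<i> * x] [a + b, a + c, a + h] 1 =
    (\<Sum>i\<le>k. pochhammer (- of_nat k) i * pochhammer (of_nat k + a + b + c + h - 1) i *
        (pochhammer (a + \<i> * x) i * pochhammer (a - \<i> * x) i) /
        (pochhammer (a + b) i * pochhammer (a + c) i * pochhammer (a + h) i) / fact i)"
    unfolding hypergeo_altdef by (subst suminf_finite[of "{..k}"]) (auto simp: pochhammer_of_nat_eq_0_iff mult_ac intro!: sum.cong)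
  also have "\<dots> = (\<Sum>i\<le>k. (-1) ^ i * of_nat (k choose i) * pochhammer (of_nat k + a + b + c + h - 1) i *
        (pochhammer (a + \<i> * x) i * pochhammer (a - \<i> * x) i) /
        (pochhammer (a + b) i * pochhammer (a + c) i * pochhammer (a + h) i))"
    by (intro sum.cong refl) (simp add: pochhammer_minus_of_nat mult_ac)
  finally show ?thesis by (simp add: wilson_def)
qed

lemma Gamma_plus_of_nat:
  assumes "0 < Re z"
  shows "Gamma (z + of_nat n) = pochhammer z n * Gamma z"
  using assms by (simp add: pochhammer_Gamma not_nonpos_Int_Re_pos Gamma_neq_0)

lemma gamma_pair_plus_of_nat:
  assumes "0 < Re a"
  shows "gamma_pair (a + of_nat n) (\<i> * of_real x) =
    pochhammer (a + \<i> * of_real x) n * pochhammer (a - \<i> * of_real x) n * gamma_pair a (\<i> * of_real x)"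
proof -
  have "a + of_nat n + \<i> * of_real x = a + \<i> * of_real x + of_nat n"
    "a + of_nat n - \<i> * of_real x = a - \<i> * of_real x + of_nat n" by simp_all
  then show ?thesis
    using assms unfolding gamma_pair_def by (simp only:) (simp add: Gamma_plus_of_nat mult_ac)
qed

lemma wilson_weight_shift:
  assumes "0 < Re a" "0 < Re b"
  shows "wilson_weight (a + of_nat i) (b + of_nat j) c h (\<i> * of_real x) =
    (pochhammer (a + \<i> * of_real x) i * pochhammer (a - \<i> * of_real x) i) *
    (pochhammer (b + \<i> * of_real x) j * pochhammer (b - \<i> * of_real x) j) * wilson_weight a b c h (\<i> * of_real x)"
  using assms by (simp add: wilson_weight_def gamma_pair_plus_of_nat mult_ac)

lemma wilson_times_weight:
  assumes "0 < Re a" "0 < Re b"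
  shows "pochhammer (b + \<i> * of_real x) j * pochhammer (b - \<i> * of_real x) j * wilson k (of_real x) a b c h *
      wilson_weight a b c h (\<i> * of_real x) =
    (\<Sum>i\<le>k. pochhammer (a + b) k * pochhammer (a + c) k * pochhammer (a + h) k *
      ((-1) ^ i * of_nat (k choose i) * pochhammer (of_nat k + a + b + c + h - 1) i /
        (pochhammer (a + b) i * pochhammer (a + c) i * pochhammer (a + h) i)) *
      wilson_weight (a + of_nat i) (b + of_nat j) c h (\<i> * of_real x))"
  unfolding wilson_weight_shift[OF assms] wilson_finite_sum
  by (simp add: sum_distrib_left sum_distrib_right mult_ac)

lemma wilson_value_shift:
  assumes "0 < Re a" "0 < Re b" "0 < Re c" "0 < Re h"
  shows "wilson_value (a + of_nat i) (b + of_nat j) c h = 4 * of_real pi *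
    (Gamma (a + c) * Gamma (a + h) * Gamma (c + h) * Gamma (a + b + of_nat j) * Gamma (b + c + of_nat j) * Gamma (b + h + of_nat j)) /
    Gamma (a + b + c + h + of_nat j) *
    (pochhammer (a + b + of_nat j) i * pochhammer (a + c) i * pochhammer (a + h) i / pochhammer (a + b + c + h + of_nat j) i)"
proof -
  have eq: "a + of_nat i + (b + of_nat j) = a + b + of_nat j + of_nat i" "a + of_nat i + c = a + c + of_nat i"
    "a + of_nat i + h = a + h + of_nat i" "b + of_nat j + c = b + c + of_nat j" "b + of_nat j + h = b + h + of_nat j"
    "a + of_nat i + (b + of_nat j) + c + h = a + b + c + h + of_nat j + of_nat i"
    by simp_all
  have G: "Gamma (a + b + of_nat j + of_nat i) = pochhammer (a + b + of_nat j) i * Gamma (a + b + of_nat j)"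
    "Gamma (a + c + of_nat i) = pochhammer (a + c) i * Gamma (a + c)"
    "Gamma (a + h + of_nat i) = pochhammer (a + h) i * Gamma (a + h)"
    "Gamma (a + b + c + h + of_nat j + of_nat i) = pochhammer (a + b + c + h + of_nat j) i * Gamma (a + b + c + h + of_nat j)"
    using assms by (intro Gamma_plus_of_nat; simp)+
  show ?thesis
    unfolding wilson_value_def eq(6) unfolding eq(1-5) unfolding G by (simp add: mult_ac)
qed

text \<open>Shifting a by i brings factors (a + c)_i (a + h)_i that cancel against the denominators
  of W_k. What is left is a balanced 3F2 with upper parameters k + s - 1, a + b + j and lower
  parameters a + b, s + j, where s = a + b + c + h. Saalschuetz contributes (-j)_k, which vanishes
  for j < k.\<close>

lemma wilson_moment:
  assumes re: "0 < Re a" "0 < Re b" "0 < Re c" "0 < Re h"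
  shows "has_bochner_integral lborel
      (\<lambda>x. pochhammer (b + \<i> * of_real x) j * pochhammer (b - \<i> * of_real x) j * wilson k (of_real x) a b c h *
        wilson_weight a b c h (\<i> * of_real x))
      (4 * of_real pi * (Gamma (a + c + of_nat k) * Gamma (a + h + of_nat k) * Gamma (c + h + of_nat k) *
         Gamma (a + b + of_nat j) * Gamma (b + c + of_nat j) * Gamma (b + h + of_nat j)) *
         pochhammer (- of_nat j) k / Gamma (a + b + c + h + of_nat j + of_nat k))"
proof -
  define s where "s = a + b + c + h"
  define p where "p = pochhammer (a + b) k * pochhammer (a + c) k * pochhammer (a + h) k"
  define e where "e = (\<lambda>i. (-1) ^ i * of_nat (k choose i) * pochhammer (of_nat k + s - 1) i)"
  define K where "K = 4 * of_real pi *
    (Gamma (a + c) * Gamma (a + h) * Gamma (c + h) * Gamma (a + b + of_nat j) * Gamma (b + c + of_nat j) * Gamma (b + h + of_nat j)) /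
    Gamma (s + of_nat j)"
  have nz: "pochhammer (a + b) i \<noteq> 0" "pochhammer (a + c) i \<noteq> 0" "pochhammer (a + h) i \<noteq> 0"
    "pochhammer (s + of_nat j) i \<noteq> 0" "pochhammer (c + h) i \<noteq> 0" for i
    using re by (auto intro!: pochhammer_neq_0 simp: s_def)
  have "has_bochner_integral lborel
      (\<lambda>x. pochhammer (b + \<i> * of_real x) j * pochhammer (b - \<i> * of_real x) j * wilson k (of_real x) a b c h *
        wilson_weight a b c h (\<i> * of_real x))
     (\<Sum>i\<le>k. p * (e i / (pochhammer (a + b) i * pochhammer (a + c) i * pochhammer (a + h) i)) *
        wilson_value (a + of_nat i) (b + of_nat j) c h)"
  proof -
    have w: "has_bochner_integral lborel (\<lambda>x. wilson_weight (a + of_nat i) (b + of_nat j) c h (\<i> * of_real x))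
       (wilson_value (a + of_nat i) (b + of_nat j) c h)" for i
    proof -
      have "0 < Re (a + of_nat i)" "0 < Re (b + of_nat j)" using re by auto
      then show ?thesis
        using integrable_wilson_weight wilson_integral_eq re by (simp add: has_bochner_integral_iff wilson_integral_def)
    qed
    have "of_nat k + a + b + c + h - 1 = of_nat k + s - 1"
      by (simp add: s_def)
    then show ?thesis
      unfolding wilson_times_weight[OF re(1,2)] p_def e_def
      by (simp only:) (intro has_bochner_integral_sum has_bochner_integral_mult_right w)
  qed
  also have "(\<Sum>i\<le>k. p * (e i / (pochhammer (a + b) i * pochhammer (a + c) i * pochhammer (a + h) i)) *
        wilson_value (a + of_nat i) (b + of_nat j) c h) =
     K * p * (\<Sum>i\<le>k. (-1) ^ i * of_nat (k choose i) * pochhammer (of_nat k + s - 1) i * pochhammer (a + b + of_nat j) i /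
       (pochhammer (a + b) i * pochhammer (s + of_nat j) i))"
    unfolding sum_distrib_left wilson_value_shift[OF re] s_def [symmetric] K_def [symmetric]
    by (intro sum.cong refl) (simp add: nz e_def mult_ac)
  also have "(\<Sum>i\<le>k. (-1) ^ i * of_nat (k choose i) * pochhammer (of_nat k + s - 1) i * pochhammer (a + b + of_nat j) i /
       (pochhammer (a + b) i * pochhammer (s + of_nat j) i)) =
     (-1) ^ k * pochhammer (a + b - (of_nat k + s - 1)) k * pochhammer (a + b - (a + b + of_nat j)) k / (pochhammer (a + b) k * pochhammer (s + of_nat j) k)"
    by (rule saalschuetz_sum[OF nz(1,4)]) simp
  also have "a + b - (of_nat k + s - 1) = 1 - (c + h) - of_nat k"
    by (simp add: s_def)
  also have "pochhammer \<dots> k = (-1) ^ k * pochhammer (c + h) k"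
    by (rule pochhammer_reflect)
  also have "a + b - (a + b + of_nat j) = - of_nat j"
    by simp
  also have "K * p * ((-1) ^ k * ((-1) ^ k * pochhammer (c + h) k) * pochhammer (- of_nat j) k / (pochhammer (a + b) k * pochhammer (s + of_nat j) k)) =
     (4 * of_real pi * (Gamma (a + c + of_nat k) * Gamma (a + h + of_nat k) * Gamma (c + h + of_nat k) *
         Gamma (a + b + of_nat j) * Gamma (b + c + of_nat j) * Gamma (b + h + of_nat j)) *
         pochhammer (- of_nat j) k / Gamma (s + of_nat j + of_nat k))"
  proof -
    have G: "Gamma (a + c + of_nat k) = pochhammer (a + c) k * Gamma (a + c)"
      "Gamma (a + h + of_nat k) = pochhammer (a + h) k * Gamma (a + h)"
      "Gamma (c + h + of_nat k) = pochhammer (c + h) k * Gamma (c + h)"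
      "Gamma (s + of_nat j + of_nat k) = pochhammer (s + of_nat j) k * Gamma (s + of_nat j)"
      using re by (intro Gamma_plus_of_nat; simp add: s_def)+
    have "(-1) ^ k * ((-1) ^ k * pochhammer (c + h) k) = pochhammer (c + h) k"
      by (simp flip: power_add mult.assoc)
    then show ?thesis
      unfolding G K_def p_def using nz(1)[of k] by (simp add: mult_ac)
  qed
  finally show ?thesis by (simp add: s_def)
qed

text \<open>The coefficient of \<rho>^n in 2F1(a + y, c + y; a + c; \<rho>) 2F1(b - y, d - y; b + d;
  \<rho>).\<close>

definition generating_coeff :: "complex \<Rightarrow> complex \<Rightarrow> complex \<Rightarrow> complex \<Rightarrow> nat \<Rightarrow> complex \<Rightarrow> complex" where
  "generating_coeff a b c d n y =
    (\<Sum>l\<le>n. pochhammer (b - y) (n - l) * pochhammer (d - y) (n - l) / (pochhammer (b + d) (n - l) * fact (n - l)) *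
            (pochhammer (a + y) l * pochhammer (c + y) l / (pochhammer (a + c) l * fact l)))"

lemma generating_coeff_eq:
  assumes "0 < Re a" "0 < Re b" "0 < Re c" "0 < Re d"
  shows "generating_coeff a b c d n y = (\<Sum>M\<le>n. (-1) ^ M *
            (pochhammer (a + b + of_nat M) (n - M) * pochhammer (b + c + of_nat M) (n - M)) *
            pochhammer (of_nat n + a + b + c + d - 1) M /
            (fact M * fact (n - M) * pochhammer (a + c) n * pochhammer (b + d) M) *
            (pochhammer (b + y) M * pochhammer (b - y) M))"
  unfolding generating_coeff_def
  by (subst wilson_generating_coeff) (use assms in \<open>auto intro!: pochhammer_neq_0 sum.cong simp: mult_ac\<close>)

text \<open>For n < k every moment involved is 0. Otherwise only M = k + r contributes, and the sum
  over r is again a balanced 3F2, of length N = n - k. The difference d - h in the answer measures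
  how far the parameters of the generating function are from those of the weight.\<close>

lemma generating_moment:
  assumes re: "0 < Re a" "0 < Re b" "0 < Re c" "0 < Re d" "0 < Re h"
  shows "has_bochner_integral lborel
      (\<lambda>x. generating_coeff a b c d n (\<i> * of_real x) * wilson k (of_real x) a b c h * wilson_weight a b c h (\<i> * of_real x))
      (if n < k then 0 else
        4 * of_real pi * (Gamma (a + c) * Gamma (a + b + of_nat k) * Gamma (a + h + of_nat k) *
          Gamma (b + c + of_nat k) * Gamma (c + h + of_nat k) * Gamma (b + h + of_nat k)) /
        (pochhammer (b + d) k * Gamma (a + b + c + h + of_nat (2 * k))) *
        (pochhammer (d - h) (n - k) * pochhammer (a + b + of_nat k) (n - k) * pochhammer (b + c + of_nat k) (n - k) *
         pochhammer (of_nat n + a + b + c + d - 1) k /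
         (pochhammer (a + b + c + h + of_nat (2 * k)) (n - k) * pochhammer (b + d + of_nat k) (n - k) * fact (n - k))))"
proof -
  define s D where "s = a + b + c + h" and "D = of_nat n + a + b + c + d - 1"
  define e where "e = (\<lambda>M. (-1) ^ M *
            (pochhammer (a + b + of_nat M) (n - M) * pochhammer (b + c + of_nat M) (n - M)) * pochhammer D M /
            (fact M * fact (n - M) * pochhammer (a + c) n * pochhammer (b + d) M))"
  define m where "m = (\<lambda>M. 4 * of_real pi * (Gamma (a + c + of_nat k) * Gamma (a + h + of_nat k) * Gamma (c + h + of_nat k) *
         Gamma (a + b + of_nat M) * Gamma (b + c + of_nat M) * Gamma (b + h + of_nat M)) *
         pochhammer (- of_nat M) k / Gamma (s + of_nat M + of_nat k))"
  have nz: "pochhammer (a + c) i \<noteq> 0" "pochhammer (b + d) i \<noteq> 0" "pochhammer (s + of_nat (2 * k)) i \<noteq> 0"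
    "pochhammer (b + d + of_nat k) i \<noteq> 0" for i
    using re by (auto intro!: pochhammer_neq_0 simp: s_def)
  have "has_bochner_integral lborel
      (\<lambda>x. generating_coeff a b c d n (\<i> * of_real x) * wilson k (of_real x) a b c h * wilson_weight a b c h (\<i> * of_real x))
      (\<Sum>M\<le>n. e M * m M)"
  proof -
    have "has_bochner_integral lborel
       (\<lambda>x. \<Sum>M\<le>n. e M * (pochhammer (b + \<i> * of_real x) M * pochhammer (b - \<i> * of_real x) M *
          wilson k (of_real x) a b c h * wilson_weight a b c h (\<i> * of_real x))) (\<Sum>M\<le>n. e M * m M)"
      unfolding m_def s_def
      by (intro has_bochner_integral_sum has_bochner_integral_mult_right wilson_moment re)
    then show ?thesis
      unfolding generating_coeff_eq[OF re(1-4)] e_def D_def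
      by (simp add: sum_distrib_right mult.assoc)
  qed
  moreover have "(\<Sum>M\<le>n. e M * m M) = (if n < k then 0 else
        4 * of_real pi * (Gamma (a + c) * Gamma (a + b + of_nat k) * Gamma (a + h + of_nat k) *
          Gamma (b + c + of_nat k) * Gamma (c + h + of_nat k) * Gamma (b + h + of_nat k)) /
        (pochhammer (b + d) k * Gamma (s + of_nat (2 * k))) *
        (pochhammer (d - h) (n - k) * pochhammer (a + b + of_nat k) (n - k) * pochhammer (b + c + of_nat k) (n - k) *
         pochhammer D k /
         (pochhammer (s + of_nat (2 * k)) (n - k) * pochhammer (b + d + of_nat k) (n - k) * fact (n - k))))"
  proof (cases "n < k")
    case True
    then have "m M = 0" if "M \<le> n" for M
      using that by (simp add: m_def pochhammer_of_nat_eq_0_iff)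
    then show ?thesis using True by simp
  next
    case False
    then obtain N where n: "n = k + N" by (metis le_add_diff_inverse not_less)
    define K where "K = 4 * of_real pi * (Gamma (a + c + of_nat k) * Gamma (a + h + of_nat k) * Gamma (c + h + of_nat k) *
       Gamma (a + b + of_nat n) * Gamma (b + c + of_nat n)) / pochhammer (a + c) n"
    define L where "L = pochhammer D k * Gamma (b + h + of_nat k) / (pochhammer (b + d) k * Gamma (s + of_nat (2 * k)) * fact N)"
    \<comment> \<open>The symbols (a + b + M)_(n-M) and (b + c + M)_(n-M) complete the Gamma values
      at M to values at n, which can be taken out of the sum.\<close>
    have em: "e M * m M = K * ((-1) ^ M * pochhammer D M * Gamma (b + h + of_nat M) * pochhammer (- of_nat M) k /
        (fact M * fact (n - M) * pochhammer (b + d) M * Gamma (s + of_nat M + of_nat k)))" if M: "M \<le> n" for M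
    proof -
      have 1: "of_nat n = (of_nat M + of_nat (n - M) :: complex)"
        using M by (simp flip: of_nat_add)
      have "Gamma (a + b + of_nat n) = pochhammer (a + b + of_nat M) (n - M) * Gamma (a + b + of_nat M)"
        "Gamma (b + c + of_nat n) = pochhammer (b + c + of_nat M) (n - M) * Gamma (b + c + of_nat M)"
        unfolding 1 add.assoc [symmetric] using re by (intro Gamma_plus_of_nat; simp)+
      then show ?thesis
        by (simp add: e_def m_def K_def mult_ac)
    qed
    have "(\<Sum>M\<le>n. e M * m M) = (\<Sum>M\<in>{k..k + N}. e M * m M)"
      using n by (intro sum.mono_neutral_right) (auto simp: m_def pochhammer_of_nat_eq_0_iff)
    also have "\<dots> = (\<Sum>r\<le>N. e (k + r) * m (k + r))"
      by (rule sum.reindex_bij_witness[of _ "\<lambda>r. k + r" "\<lambda>M. M - k"]) auto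
    also have "\<dots> = (\<Sum>r\<le>N. K * L * ((-1) ^ r * of_nat (N choose r) * pochhammer (b + h + of_nat k) r * pochhammer (D + of_nat k) r /
        (pochhammer (b + d + of_nat k) r * pochhammer (s + of_nat (2 * k)) r)))"
    proof (intro sum.cong refl)
      fix r assume "r \<in> {..N}"
      then have r: "r \<le> N" by simp
      have 1: "pochhammer (- of_nat (k + r)) k = ((-1) ^ k * fact (k + r) / fact r :: complex)"
        unfolding pochhammer_minus_of_nat by (simp add: binomial_fact)
      have 2: "Gamma (b + h + of_nat (k + r)) = pochhammer (b + h + of_nat k) r * Gamma (b + h + of_nat k)"
        using Gamma_plus_of_nat[of "b + h + of_nat k" r] re by (simp add: add_ac)
      have 3: "Gamma (s + of_nat (k + r) + of_nat k) = pochhammer (s + of_nat (2 * k)) r * Gamma (s + of_nat (2 * k))"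
        using Gamma_plus_of_nat[of "s + of_nat (2 * k)" r] re by (simp add: s_def algebra_simps)
      have 4: "n - (k + r) = N - r" using n by simp
      have 5: "(-1) ^ (k + r) * ((-1) ^ k * F) = (-1) ^ r * F" for F :: complex
        by (simp add: power_add flip: mult.assoc)
      have 6: "of_nat (N choose r) = (fact N / (fact r * fact (N - r)) :: complex)"
        by (rule binomial_fact[OF r])
      have "e (k + r) * m (k + r) = K * (((-1) ^ (k + r) * ((-1) ^ k * (fact (k + r) / fact r))) * pochhammer D (k + r) * Gamma (b + h + of_nat (k + r)) /
        (fact (k + r) * fact (n - (k + r)) * pochhammer (b + d) (k + r) * Gamma (s + of_nat (k + r) + of_nat k)))"
        using em[of "k + r"] n r unfolding 1 by (simp add: mult_ac)
      also have "\<dots> = K * L * ((-1) ^ r * of_nat (N choose r) * pochhammer (b + h + of_nat k) r * pochhammer (D + of_nat k) r /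
        (pochhammer (b + d + of_nat k) r * pochhammer (s + of_nat (2 * k)) r))"
        unfolding 2 3 4 5 6 pochhammer_product' L_def by (simp add: mult_ac)
      finally show "e (k + r) * m (k + r) = K * L * ((-1) ^ r * of_nat (N choose r) * pochhammer (b + h + of_nat k) r * pochhammer (D + of_nat k) r /
        (pochhammer (b + d + of_nat k) r * pochhammer (s + of_nat (2 * k)) r))" .
    qed
    also have "\<dots> = K * L * ((-1) ^ N * pochhammer (b + d + of_nat k - (b + h + of_nat k)) N * pochhammer (b + d + of_nat k - (D + of_nat k)) N /
        (pochhammer (b + d + of_nat k) N * pochhammer (s + of_nat (2 * k)) N))"
      unfolding sum_distrib_left [symmetric]
      by (subst saalschuetz_sum[OF nz(4,3)]) (simp_all add: s_def D_def n)
    also have "b + d + of_nat k - (b + h + of_nat k) = d - h" by simp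
    \<comment> \<open>After reflection this gives (a + c + k)_N, which cancels the second part of
      the denominator (a + c)_n; the first part, (a + c)_k, reduces Gamma(a + c + k) to Gamma(a +
      c).\<close>
    also have "b + d + of_nat k - (D + of_nat k) = 1 - (a + c + of_nat k) - of_nat N"
      by (simp add: D_def n)
    also have "pochhammer \<dots> N = (-1) ^ N * pochhammer (a + c + of_nat k) N"
      by (rule pochhammer_reflect)
    also have "(-1) ^ N * pochhammer (d - h) N * ((-1) ^ N * pochhammer (a + c + of_nat k) N) = pochhammer (d - h) N * pochhammer (a + c + of_nat k) N"
      by (simp add: mult_ac)
    also have "K * L * (pochhammer (d - h) N * pochhammer (a + c + of_nat k) N / (pochhammer (b + d + of_nat k) N * pochhammer (s + of_nat (2 * k)) N)) =
        4 * of_real pi * (Gamma (a + c) * Gamma (a + b + of_nat k) * Gamma (a + h + of_nat k) *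
          Gamma (b + c + of_nat k) * Gamma (c + h + of_nat k) * Gamma (b + h + of_nat k)) /
        (pochhammer (b + d) k * Gamma (s + of_nat (2 * k))) *
        (pochhammer (d - h) N * pochhammer (a + b + of_nat k) N * pochhammer (b + c + of_nat k) N *
         pochhammer D k /
         (pochhammer (s + of_nat (2 * k)) N * pochhammer (b + d + of_nat k) N * fact N))"
    proof -
      have 1: "a + b + of_nat n = a + b + of_nat k + of_nat N" "b + c + of_nat n = b + c + of_nat k + of_nat N"
        by (simp_all add: n)
      have 2: "Gamma (a + b + of_nat k + of_nat N) = pochhammer (a + b + of_nat k) N * Gamma (a + b + of_nat k)"
        "Gamma (b + c + of_nat k + of_nat N) = pochhammer (b + c + of_nat k) N * Gamma (b + c + of_nat k)"
        "Gamma (a + c + of_nat k) = pochhammer (a + c) k * Gamma (a + c)"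
        using re by (intro Gamma_plus_of_nat; simp)+
      have 3: "pochhammer (a + c) n = pochhammer (a + c) k * pochhammer (a + c + of_nat k) N"
        by (simp add: n pochhammer_product')
      have "pochhammer (a + c) k \<noteq> 0" "pochhammer (a + c + of_nat k) N \<noteq> 0"
        using nz(1)[of n] unfolding 3 by auto
      then show ?thesis
        unfolding K_def L_def 1 2 3 by (simp add: mult_ac)
    qed
    finally show ?thesis using n by simp
  qed
  ultimately show ?thesis by (simp only: s_def D_def)
qed

section \<open>Growth of the hypergeometric coefficients\<close>

text \<open>
  \<open>(z)\<^sub>n / n!\<close> is up to sign a Taylor coefficient of \<open>(1 + t) powr (-z)\<close>, so Cauchy's inequality on
  \<open>\<bar>t\<bar> = s < 1\<close> applies; there \<open>\<bar>arg (1 + t)\<bar>\<close> stays away from \<open>\<pi>/2\<close>.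
\<close>
lemma pochhammer_line_bound:
  assumes s: "0 < s" "s < 1"
  shows "\<exists>\<theta>. 0 \<le> \<theta> \<and> \<theta> < pi / 2 \<and> (\<forall>a. \<exists>K>0. \<forall>(x::real) n. norm (pochhammer (a + \<i> * of_real x) n) \<le> fact n / s ^ n * (K * exp (\<theta> * \<bar>x\<bar>)))"
proof -
  have re: "0 < Re (1 + t)" if "t \<in> cball 0 s" for t :: complex
    using that s abs_Re_le_cmod[of t] by auto
  have nonpos: "1 + t \<notin> \<real>\<^sub>\<le>\<^sub>0" if "t \<in> cball 0 s" for t :: complex
    using re[OF that] by (auto simp: complex_nonpos_Reals_iff)
  have cont: "continuous_on (cball 0 s) (\<lambda>t::complex. Ln (1 + t))"
    by (intro continuous_intros nonpos) auto
  have "\<exists>u\<in>cball 0 s. \<forall>t\<in>cball 0 s. \<bar>Im (Ln (1 + t))\<bar> \<le> \<bar>Im (Ln (1 + u))\<bar>"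
    using s by (intro continuous_attains_sup continuous_intros cont) auto
  then obtain u where u: "u \<in> cball 0 s" "\<And>t. t \<in> cball 0 s \<Longrightarrow> \<bar>Im (Ln (1 + t))\<bar> \<le> \<bar>Im (Ln (1 + u))\<bar>"
    by blast
  define \<theta> where "\<theta> = \<bar>Im (Ln (1 + u))\<bar>"
  have \<theta>: "0 \<le> \<theta>" "\<theta> < pi / 2"
    using Re_Ln_pos_lt_imp[OF re[OF u(1)]] by (auto simp: \<theta>_def)
  have "compact ((\<lambda>t. Ln (1 + t)) ` cball 0 s)"
    by (intro compact_continuous_image cont) auto
  then have "bounded ((\<lambda>t. Ln (1 + t)) ` cball 0 s)"
    by (rule compact_imp_bounded)
  then obtain B where B: "B > 0" "\<And>t. t \<in> cball 0 s \<Longrightarrow> norm (Ln (1 + t)) \<le> B"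
    unfolding bounded_pos by auto
  \<comment> \<open>Only the argument of 1 + t is multiplied by x in the exponent, whereas a costs
    just a constant. Thus one \<theta>, depending on s alone, serves every a and every n.\<close>
  have "\<exists>K>0. \<forall>(x::real) n. norm (pochhammer (a + \<i> * of_real x) n) \<le> fact n / s ^ n * (K * exp (\<theta> * \<bar>x\<bar>))" for a :: complex
  proof (intro exI[of _ "exp (norm a * B)"] conjI allI)
    fix x :: real and n :: nat
    define z where "z = a + \<i> * of_real x"
    define f where "f = (\<lambda>t. (1 + t) powr (- z))"
    have nz: "1 + t \<noteq> 0" if "t \<in> cball 0 s" for t :: complex
      using re[OF that] by (metis less_irrefl zero_complex.simps(1))
    have bound: "norm (f t) \<le> exp (norm a * B) * exp (\<theta> * \<bar>x\<bar>)" if t: "t \<in> cball 0 s" for t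
    proof -
      have "norm (f t) = exp (Re (- z * Ln (1 + t)))"
        using nz[OF t] by (simp add: f_def powr_def)
      also have "Re (- z * Ln (1 + t)) = Re (- a * Ln (1 + t)) + x * Im (Ln (1 + t))"
        by (simp add: z_def algebra_simps)
      also have "\<dots> \<le> norm a * B + \<theta> * \<bar>x\<bar>"
      proof (intro add_mono)
        have "Re (- a * Ln (1 + t)) \<le> norm (- a * Ln (1 + t))" by (rule complex_Re_le_cmod)
        also have "\<dots> \<le> norm a * B"
          unfolding norm_mult norm_minus_cancel using B(2)[OF t] by (intro mult_left_mono) auto
        finally show "Re (- a * Ln (1 + t)) \<le> norm a * B" .
        have "x * Im (Ln (1 + t)) \<le> \<bar>x\<bar> * \<bar>Im (Ln (1 + t))\<bar>"
          by (metis abs_ge_self abs_mult)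
        also have "\<dots> \<le> \<bar>x\<bar> * \<theta>"
          using u(2)[OF t] by (intro mult_left_mono) (auto simp: \<theta>_def)
        finally show "x * Im (Ln (1 + t)) \<le> \<theta> * \<bar>x\<bar>" by (simp add: mult.commute)
      qed
      finally show ?thesis by (simp add: exp_add)
    qed
    have cont_f: "continuous_on (cball 0 s) f"
    proof -
      have "continuous_on (cball 0 s) (\<lambda>t. exp (- z * Ln (1 + t)))"
        by (intro continuous_intros cont)
      then show ?thesis
        by (rule continuous_on_eq) (use nz in \<open>simp add: f_def powr_def\<close>)
    qed
    have holo_f: "f holomorphic_on ball 0 s"
      unfolding f_def by (intro holomorphic_intros nonpos) auto
    have "norm ((deriv ^^ n) f 0) \<le> fact n * (exp (norm a * B) * exp (\<theta> * \<bar>x\<bar>)) / s ^ n"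
      by (rule Cauchy_inequality[OF holo_f cont_f s(1)]) (intro bound, auto)
    moreover have "(deriv ^^ n) f 0 / fact n = (- z) gchoose n"
      using fps_nth_fps_expansion[OF has_fps_expansion_binomial_complex[of "- z"], of n]
      by (simp add: f_def [symmetric])
    then have "(deriv ^^ n) f 0 = (-1) ^ n * pochhammer z n"
      by (simp add: gbinomial_pochhammer)
    ultimately show "norm (pochhammer (a + \<i> * of_real x) n) \<le> fact n / s ^ n * (exp (norm a * B) * exp (\<theta> * \<bar>x\<bar>))"
      by (simp add: norm_mult norm_power z_def)
  qed simp
  with \<theta> show ?thesis by blast
qed

text \<open>From (\<sigma>)_n = \<sigma> (\<sigma> + 1)_(n-1) >= \<sigma> (n - 1)! for n > 0. The
  linear loss is harmless against a geometric factor.\<close>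

lemma fact_le_pochhammer:
  fixes \<sigma> :: real
  assumes "0 < \<sigma>"
  shows "fact n \<le> real (n + 1) * (1 + 1 / \<sigma>) * pochhammer \<sigma> n"
proof (cases n)
  case 0
  then show ?thesis using assms by simp
next
  case (Suc m)
  have "fact m \<le> pochhammer (\<sigma> + 1) m"
  proof -
    have "pochhammer 1 m \<le> pochhammer (\<sigma> + 1) m"
      unfolding pochhammer_prod using assms by (intro prod_mono) auto
    then show ?thesis by (simp add: pochhammer_fact)
  qed
  then have "fact n \<le> real n * (1 / \<sigma>) * pochhammer \<sigma> n"
    using assms by (simp add: Suc pochhammer_rec)
  also have "\<dots> \<le> real (n + 1) * (1 + 1 / \<sigma>) * pochhammer \<sigma> n"
    using assms pochhammer_pos[OF assms, of n] by (intro mult_right_mono mult_mono) auto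
  finally show ?thesis .
qed

definition hyper_coeff :: "complex \<Rightarrow> complex \<Rightarrow> nat \<Rightarrow> complex \<Rightarrow> complex" where
  "hyper_coeff a c n y = pochhammer (a + y) n * pochhammer (c + y) n / (pochhammer (a + c) n * fact n)"

lemma hyper_coeff_bound:
  assumes "0 < Re (a + c)" "0 \<le> r" "r < 1"
  shows "\<exists>\<theta> C. \<theta> < pi \<and> (\<forall>x::real. summable (\<lambda>n. norm (hyper_coeff a c n (\<i> * of_real x)) * r ^ n) \<and>
     (\<Sum>n. norm (hyper_coeff a c n (\<i> * of_real x)) * r ^ n) \<le> C * exp (\<theta> * \<bar>x\<bar>))"
proof -
  \<comment> \<open>Each of the two numerator symbols costs a factor q^(-n), and q^2 lies strictly
    between r and 1, so r / q^2 < 1. The two growth rates add up to 2 \<theta> < \<pi>.\<close>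
  define q where "q = sqrt ((1 + r) / 2)"
  have q: "0 < q" "q < 1" "r < q\<^sup>2"
    using assms by (auto simp: q_def)
  obtain \<theta> where \<theta>: "0 \<le> \<theta>" "\<theta> < pi / 2"
    "\<And>a. \<exists>K>0. \<forall>(x::real) n. norm (pochhammer (a + \<i> * of_real x) n) \<le> fact n / q ^ n * (K * exp (\<theta> * \<bar>x\<bar>))"
    using pochhammer_line_bound[OF q(1,2)] by blast
  obtain A where A: "A > 0" "\<And>(x::real) n. norm (pochhammer (a + \<i> * of_real x) n) \<le> fact n / q ^ n * (A * exp (\<theta> * \<bar>x\<bar>))"
    using \<theta>(3)[of a] by blast
  obtain B where B: "B > 0" "\<And>(x::real) n. norm (pochhammer (c + \<i> * of_real x) n) \<le> fact n / q ^ n * (B * exp (\<theta> * \<bar>x\<bar>))"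
    using \<theta>(3)[of c] by blast
  define \<sigma> where "\<sigma> = Re (a + c)"
  have \<sigma>: "0 < \<sigma>" using assms by (simp add: \<sigma>_def)
  define L where "L = A * B * (1 + 1 / \<sigma>)"
  define w where "w = r / q\<^sup>2"
  have w: "0 \<le> w" "w < 1" using q assms by (auto simp: w_def)
  have bound: "norm (hyper_coeff a c n (\<i> * of_real x)) * r ^ n \<le> L * exp (2 * \<theta> * \<bar>x\<bar>) * (real (n + 1) * w ^ n)" for x :: real and n
  proof -
    have "norm (hyper_coeff a c n (\<i> * of_real x)) =
        norm (pochhammer (a + \<i> * of_real x) n) * norm (pochhammer (c + \<i> * of_real x) n) / (norm (pochhammer (a + c) n) * fact n)"
      by (simp add: hyper_coeff_def norm_mult norm_divide)
    also have "\<dots> \<le> (fact n / q ^ n * (A * exp (\<theta> * \<bar>x\<bar>))) * (fact n / q ^ n * (B * exp (\<theta> * \<bar>x\<bar>))) / (norm (pochhammer (a + c) n) * fact n)"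
      using A B q by (intro divide_right_mono mult_mono) (auto simp: less_imp_le)
    also have "\<dots> = A * B * (exp (\<theta> * \<bar>x\<bar>) * exp (\<theta> * \<bar>x\<bar>)) / (q\<^sup>2) ^ n * (fact n / norm (pochhammer (a + c) n))"
      by (simp add: power_mult [symmetric] mult.commute[of 2] power_add mult_2_right mult_ac)
    also have "exp (\<theta> * \<bar>x\<bar>) * exp (\<theta> * \<bar>x\<bar>) = exp (2 * \<theta> * \<bar>x\<bar>)"
      by (simp flip: exp_add)
    also have "A * B * exp (2 * \<theta> * \<bar>x\<bar>) / (q\<^sup>2) ^ n * (fact n / norm (pochhammer (a + c) n)) \<le>
        A * B * exp (2 * \<theta> * \<bar>x\<bar>) / (q\<^sup>2) ^ n * (real (n + 1) * (1 + 1 / \<sigma>))"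
    proof (intro mult_left_mono)
      have "fact n \<le> real (n + 1) * (1 + 1 / \<sigma>) * pochhammer \<sigma> n"
        by (rule fact_le_pochhammer[OF \<sigma>])
      also have "\<dots> \<le> real (n + 1) * (1 + 1 / \<sigma>) * norm (pochhammer (a + c) n)"
        using norm_pochhammer_ge[OF assms(1), of n] \<sigma> by (intro mult_left_mono) (auto simp: \<sigma>_def)
      finally show "fact n / norm (pochhammer (a + c) n) \<le> real (n + 1) * (1 + 1 / \<sigma>)"
        using pochhammer_neq_0[OF assms(1), of n] by (simp add: divide_le_eq)
    qed (use A B in auto)
    finally have "norm (hyper_coeff a c n (\<i> * of_real x)) * r ^ n \<le>
        A * B * exp (2 * \<theta> * \<bar>x\<bar>) / (q\<^sup>2) ^ n * (real (n + 1) * (1 + 1 / \<sigma>)) * r ^ n"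
      using assms by (intro mult_right_mono) auto
    also have "\<dots> = L * exp (2 * \<theta> * \<bar>x\<bar>) * (real (n + 1) * w ^ n)"
      by (simp add: L_def w_def power_divide mult_ac)
    finally show ?thesis .
  qed
  have sumw: "summable (\<lambda>n. real (n + 1) * w ^ n)"
  proof -
    have "summable (\<lambda>n. diffs (\<lambda>_. 1) n * w ^ n)"
      by (rule termdiff_converges[of w 1]) (use w in \<open>auto intro: summable_geometric\<close>)
    then show ?thesis by (simp add: diffs_def add.commute)
  qed
  show ?thesis
  proof (intro exI conjI allI)
    show "2 * \<theta> < pi" using \<theta> by simp
    fix x :: real
    show sum: "summable (\<lambda>n. norm (hyper_coeff a c n (\<i> * of_real x)) * r ^ n)"
      by (rule summable_comparison_test_ev[OF _ summable_mult[OF sumw]])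
         (use bound assms(2) in \<open>auto intro!: always_eventually\<close>)
    have "(\<Sum>n. norm (hyper_coeff a c n (\<i> * of_real x)) * r ^ n) \<le> (\<Sum>n. L * exp (2 * \<theta> * \<bar>x\<bar>) * (real (n + 1) * w ^ n))"
      by (intro suminf_le bound sum summable_mult sumw)
    also have "\<dots> = (L * (\<Sum>n. real (n + 1) * w ^ n)) * exp (2 * \<theta> * \<bar>x\<bar>)"
      using suminf_mult[OF sumw, of "L * exp (2 * \<theta> * \<bar>x\<bar>)"] by (simp add: mult_ac)
    finally show "(\<Sum>n. norm (hyper_coeff a c n (\<i> * of_real x)) * r ^ n) \<le> (L * (\<Sum>n. real (n + 1) * w ^ n)) * exp (2 * \<theta> * \<bar>x\<bar>)" .
  qed
qed

section \<open>Interchanging summation and integration\<close>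

lemma generating_coeff_conv_hyper_coeff:
  "generating_coeff a b c d n y = (\<Sum>l\<le>n. hyper_coeff a c l y * hyper_coeff b d (n - l) (- y))"
  by (simp add: generating_coeff_def hyper_coeff_def mult.commute)

lemma hypergeo_conv_hyper_coeff:
  "hypergeo [a + y, c + y] [a + c] z = (\<Sum>n. hyper_coeff a c n y * z ^ n)"
  by (simp add: hypergeo_altdef hyper_coeff_def)

lemma summable_norm_hyper_coeff:
  assumes "0 < Re (a + c)" "norm \<rho> < 1"
  shows "summable (\<lambda>n. norm (hyper_coeff a c n (\<i> * of_real x) * \<rho> ^ n))"
  using hyper_coeff_bound[OF assms(1) _ assms(2)] by (auto simp: norm_mult norm_power)

lemma generating_coeff_sums:
  assumes re: "0 < Re a" "0 < Re b" "0 < Re c" "0 < Re d" and \<rho>: "norm \<rho> < 1"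
  shows "(\<lambda>n. generating_coeff a b c d n (\<i> * of_real x) * \<rho> ^ n) sums
    (hypergeo [a + \<i> * of_real x, c + \<i> * of_real x] [a + c] \<rho> *
     hypergeo [b - \<i> * of_real x, d - \<i> * of_real x] [b + d] \<rho>)"
proof -
  have "summable (\<lambda>n. norm (hyper_coeff a c n (\<i> * of_real x) * \<rho> ^ n))"
    using re \<rho> by (intro summable_norm_hyper_coeff) auto
  moreover have "summable (\<lambda>n. norm (hyper_coeff b d n (- (\<i> * of_real x)) * \<rho> ^ n))"
    using summable_norm_hyper_coeff[of b d \<rho> "- x"] re \<rho> by simp
  ultimately have "(\<lambda>n. \<Sum>i\<le>n. hyper_coeff a c i (\<i> * of_real x) * \<rho> ^ i * (hyper_coeff b d (n - i) (- (\<i> * of_real x)) * \<rho> ^ (n - i))) sums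
     (hypergeo [a + \<i> * of_real x, c + \<i> * of_real x] [a + c] \<rho> *
     hypergeo [b - \<i> * of_real x, d - \<i> * of_real x] [b + d] \<rho>)"
    unfolding hypergeo_conv_hyper_coeff hypergeo_conv_hyper_coeff[of _ "- (\<i> * of_real x)", simplified add_uminus_conv_diff]
    by (rule Cauchy_product_sums)
  also have "(\<lambda>n. \<Sum>i\<le>n. hyper_coeff a c i (\<i> * of_real x) * \<rho> ^ i * (hyper_coeff b d (n - i) (- (\<i> * of_real x)) * \<rho> ^ (n - i))) =
     (\<lambda>n. generating_coeff a b c d n (\<i> * of_real x) * \<rho> ^ n)"
    unfolding generating_coeff_conv_hyper_coeff sum_distrib_right
    by (intro ext sum.cong refl) (simp flip: power_add)
  finally show ?thesis .
qed

text \<open>The bound is uniform in N because partial sums are dominated by the Cauchy product of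
  the two series of absolute values.\<close>

lemma generating_partial_sum_bound:
  assumes re: "0 < Re a" "0 < Re b" "0 < Re c" "0 < Re d" and \<rho>: "norm \<rho> < 1"
  shows "\<exists>\<theta> C. \<theta> < 2 * pi \<and> (\<forall>x N. norm (\<Sum>n<N. generating_coeff a b c d n (\<i> * of_real x) * \<rho> ^ n) \<le> C * exp (\<theta> * \<bar>x\<bar>))"
proof -
  define r where "r = norm \<rho>"
  have r: "0 \<le> r" "r < 1" using \<rho> by (auto simp: r_def)
  obtain \<theta>1 C1 where 1: "\<theta>1 < pi" "\<And>x. summable (\<lambda>n. norm (hyper_coeff a c n (\<i> * of_real x)) * r ^ n)"
     "\<And>x. (\<Sum>n. norm (hyper_coeff a c n (\<i> * of_real x)) * r ^ n) \<le> C1 * exp (\<theta>1 * \<bar>x\<bar>)"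
    using hyper_coeff_bound[of a c r] re r by auto
  obtain \<theta>2 C2 where 2: "\<theta>2 < pi" "\<And>x. summable (\<lambda>n. norm (hyper_coeff b d n (\<i> * of_real x)) * r ^ n)"
     "\<And>x. (\<Sum>n. norm (hyper_coeff b d n (\<i> * of_real x)) * r ^ n) \<le> C2 * exp (\<theta>2 * \<bar>x\<bar>)"
    using hyper_coeff_bound[of b d r] re r by auto
  have "norm (\<Sum>n<N. generating_coeff a b c d n (\<i> * of_real x) * \<rho> ^ n) \<le> (C1 * C2) * exp ((\<theta>1 + \<theta>2) * \<bar>x\<bar>)" for x N
  proof -
    define A where "A = (\<lambda>n. norm (hyper_coeff a c n (\<i> * of_real x)) * r ^ n)"
    define B where "B = (\<lambda>n. norm (hyper_coeff b d n (\<i> * of_real (- x))) * r ^ n)"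
    have A: "summable A" "suminf A \<le> C1 * exp (\<theta>1 * \<bar>x\<bar>)" "\<And>n. 0 \<le> A n"
      using 1(2,3)[of x] r by (auto simp: A_def)
    have B: "summable B" "suminf B \<le> C2 * exp (\<theta>2 * \<bar>x\<bar>)" "\<And>n. 0 \<le> B n"
      using 2(2,3)[of "- x"] r by (auto simp: B_def)
    have sums: "(\<lambda>n. \<Sum>i\<le>n. A i * B (n - i)) sums (suminf A * suminf B)"
      using A B by (intro Cauchy_product_sums) auto
    have "norm (\<Sum>n<N. generating_coeff a b c d n (\<i> * of_real x) * \<rho> ^ n) \<le> (\<Sum>n<N. \<Sum>i\<le>n. A i * B (n - i))"
    proof (intro sum_norm_le)
      fix n
      have "norm (generating_coeff a b c d n (\<i> * of_real x) * \<rho> ^ n) =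
          norm (\<Sum>i\<le>n. hyper_coeff a c i (\<i> * of_real x) * hyper_coeff b d (n - i) (\<i> * of_real (- x))) * r ^ n"
        by (simp add: generating_coeff_conv_hyper_coeff norm_mult norm_power r_def)
      also have "\<dots> \<le> (\<Sum>i\<le>n. norm (hyper_coeff a c i (\<i> * of_real x) * hyper_coeff b d (n - i) (\<i> * of_real (- x)))) * r ^ n"
        using r by (intro mult_right_mono norm_sum) auto
      also have "\<dots> = (\<Sum>i\<le>n. A i * B (n - i))"
        unfolding sum_distrib_right A_def B_def norm_mult
        by (intro sum.cong refl) (simp add: mult_ac flip: power_add)
      finally show "norm (generating_coeff a b c d n (\<i> * of_real x) * \<rho> ^ n) \<le> (\<Sum>i\<le>n. A i * B (n - i))" .
    qed
    also have "\<dots> \<le> suminf A * suminf B"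
      using sums A B by (subst sums_unique[OF sums]) (intro sum_le_suminf sums_summable[OF sums] sum_nonneg mult_nonneg_nonneg ballI; simp)
    also have "\<dots> \<le> (C1 * exp (\<theta>1 * \<bar>x\<bar>)) * (C2 * exp (\<theta>2 * \<bar>x\<bar>))"
      using A B by (intro mult_mono suminf_nonneg order.trans[OF suminf_nonneg A(2)]) auto
    also have "\<dots> = (C1 * C2) * exp ((\<theta>1 + \<theta>2) * \<bar>x\<bar>)"
      unfolding distrib_right exp_add by (simp only: mult_ac)
    finally show ?thesis .
  qed
  moreover have "\<theta>1 + \<theta>2 < 2 * pi" using 1(1) 2(1) by simp
  ultimately show ?thesis by blast
qed

text \<open>The growth of W_k is never estimated: each term of its expansion is absorbed into a
  weight with a replaced by a + i.\<close>

lemma integrable_exp_wilson_times_weight: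
  assumes re: "0 < Re a" "0 < Re b" "0 < Re c" "0 < Re h" and \<theta>: "\<theta> < 2 * pi"
  shows "integrable lborel (\<lambda>x. exp (\<theta> * \<bar>x\<bar>) * norm (wilson k (of_real x) a b c h * wilson_weight a b c h (\<i> * of_real x)))"
proof -
  define e where "e = (\<lambda>i. pochhammer (a + b) k * pochhammer (a + c) k * pochhammer (a + h) k *
      ((-1) ^ i * of_nat (k choose i) * pochhammer (of_nat k + a + b + c + h - 1) i /
        (pochhammer (a + b) i * pochhammer (a + c) i * pochhammer (a + h) i)))"
  have eq: "wilson k (of_real x) a b c h * wilson_weight a b c h (\<i> * of_real x) =
     (\<Sum>i\<le>k. e i * wilson_weight (a + of_nat i) b c h (\<i> * of_real x))" for x :: real
    using wilson_times_weight[OF re(1,2), of x 0 k c h] by (simp add: e_def)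
  have re': "0 < Re (a + of_nat i)" for i using re by auto
  have [measurable]: "(\<lambda>x::real. wilson_weight (a + of_nat i) b c h (\<i> * of_real x)) \<in> borel_measurable borel" for i
    by (intro borel_measurable_wilson_weight re re')
  show ?thesis
    unfolding eq
  proof (rule Bochner_Integration.integrable_bound)
    show "integrable lborel (\<lambda>x. \<Sum>i\<le>k. norm (e i) * (exp (\<theta> * \<bar>x\<bar>) * norm (wilson_weight (a + of_nat i) b c h (\<i> * of_real x))))"
      by (intro Bochner_Integration.integrable_sum integrable_mult_right integrable_exp_wilson_weight \<theta> re re')
    have "exp (\<theta> * \<bar>x\<bar>) * norm (\<Sum>i\<le>k. e i * wilson_weight (a + of_nat i) b c h (\<i> * of_real x)) \<le>
        (\<Sum>i\<le>k. norm (e i) * (exp (\<theta> * \<bar>x\<bar>) * norm (wilson_weight (a + of_nat i) b c h (\<i> * of_real x))))" for x :: real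
    proof -
      have "exp (\<theta> * \<bar>x\<bar>) * norm (\<Sum>i\<le>k. e i * wilson_weight (a + of_nat i) b c h (\<i> * of_real x)) \<le>
        exp (\<theta> * \<bar>x\<bar>) * (\<Sum>i\<le>k. norm (e i * wilson_weight (a + of_nat i) b c h (\<i> * of_real x)))"
        by (intro mult_left_mono norm_sum) auto
      then show ?thesis by (simp add: sum_distrib_left norm_mult mult_ac)
    qed
    then show "AE x in lborel. norm (exp (\<theta> * \<bar>x\<bar>) * norm (\<Sum>i\<le>k. e i * wilson_weight (a + of_nat i) b c h (\<i> * of_real x))) \<le>
        norm (\<Sum>i\<le>k. norm (e i) * (exp (\<theta> * \<bar>x\<bar>) * norm (wilson_weight (a + of_nat i) b c h (\<i> * of_real x))))"
      by (intro AE_I2) (simp add: abs_mult order.trans[OF _ abs_ge_self])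
  qed simp
qed

lemma generating_integral:
  assumes re: "0 < Re a" "0 < Re b" "0 < Re c" "0 < Re d" "0 < Re h" and \<rho>: "norm \<rho> < 1"
    and m: "\<And>n. has_bochner_integral lborel
      (\<lambda>x. generating_coeff a b c d n (\<i> * of_real x) * wilson k (of_real x) a b c h * wilson_weight a b c h (\<i> * of_real x)) (m n)"
  defines "F \<equiv> (\<lambda>x::real. hypergeo [a + \<i> * of_real x, c + \<i> * of_real x] [a + c] \<rho> *
     hypergeo [b - \<i> * of_real x, d - \<i> * of_real x] [b + d] \<rho> * wilson k (of_real x) a b c h * wilson_weight a b c h (\<i> * of_real x))"
  shows "integrable lborel F" "(\<lambda>n. m n * \<rho> ^ n) sums (LBINT x. F x)"
proof -
  obtain \<theta> C where \<theta>: "\<theta> < 2 * pi"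
    and C: "\<And>x N. norm (\<Sum>n<N. generating_coeff a b c d n (\<i> * of_real x) * \<rho> ^ n) \<le> C * exp (\<theta> * \<bar>x\<bar>)"
    using generating_partial_sum_bound[OF re(1-4) \<rho>] by blast
  define W where "W = (\<lambda>x::real. wilson k (of_real x) a b c h * wilson_weight a b c h (\<i> * of_real x))"
  define S where "S = (\<lambda>N (x::real). (\<Sum>n<N. generating_coeff a b c d n (\<i> * of_real x) * \<rho> ^ n) * W x)"
  have S: "has_bochner_integral lborel (S N) (\<Sum>n<N. m n * \<rho> ^ n)" for N
  proof -
    have "S N = (\<lambda>x. \<Sum>n<N. generating_coeff a b c d n (\<i> * of_real x) * wilson k (of_real x) a b c h *
        wilson_weight a b c h (\<i> * of_real x) * \<rho> ^ n)"
      by (intro ext) (simp add: S_def W_def sum_distrib_right sum_distrib_left mult_ac)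
    then show ?thesis
      by (simp only:) (intro has_bochner_integral_sum has_bochner_integral_mult_left m)
  qed
  have lim: "(\<lambda>N. S N x) \<longlonglongrightarrow> F x" for x
  proof -
    have "F x = (hypergeo [a + \<i> * of_real x, c + \<i> * of_real x] [a + c] \<rho> *
      hypergeo [b - \<i> * of_real x, d - \<i> * of_real x] [b + d] \<rho>) * W x"
      by (simp add: F_def W_def)
    then show ?thesis
      using generating_coeff_sums[OF re(1-4) \<rho>, of x] unfolding S_def sums_def by (simp only:) (intro tendsto_intros)
  qed
  have meas: "S N \<in> borel_measurable lborel" for N
    by (rule borel_measurable_has_bochner_integral[OF S])
  \<comment> \<open>Measurability of the hypergeometric factors in x is inherited from the partial
    sums by the pointwise limit.\<close>
  then have measF: "F \<in> borel_measurable lborel"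
    by (rule borel_measurable_LIMSEQ_metric) (rule lim)
  have dom: "integrable lborel (\<lambda>x. C * (exp (\<theta> * \<bar>x\<bar>) * norm (W x)))"
    unfolding W_def by (intro integrable_mult_right integrable_exp_wilson_times_weight re \<theta>)
  have le: "AE x in lborel. norm (S N x) \<le> C * (exp (\<theta> * \<bar>x\<bar>) * norm (W x))" for N
    unfolding S_def norm_mult mult.assoc [symmetric] by (intro AE_I2 mult_right_mono C) auto
  show "integrable lborel F"
    by (rule integrable_dominated_convergence[OF measF meas dom AE_I2[OF lim] le])
  have "(\<lambda>N. LBINT x. S N x) \<longlonglongrightarrow> (LBINT x. F x)"
    by (rule integral_dominated_convergence[OF measF meas dom AE_I2[OF lim] le])
  then show "(\<lambda>n. m n * \<rho> ^ n) sums (LBINT x. F x)"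
    using S by (simp add: sums_def has_bochner_integral_iff)
qed

section \<open>Parity and the return to the half line and the squared modulus\<close>

lemma has_integral_half_line_even:
  fixes f :: "real \<Rightarrow> complex"
  assumes int: "integrable lborel f" and even: "\<And>x. f (- x) = f x"
  shows "(f has_integral (LBINT x. f x) / 2) {0..}"
proof -
  define g where "g = (\<lambda>x. indicator {0..} x *\<^sub>R f x)"
  have g: "integrable lborel g"
    unfolding g_def using int by (intro integrable_mult_indicator) auto
  from lborel_integrable_real_affine[OF g, of "-1" 0]
  have g': "integrable lborel (\<lambda>x. g (- x))" by simp
  have "(LBINT x. f x) = (LBINT x. g x + g (- x))"
  proof (rule integral_cong_AE)
    \<comment> \<open>The point 0 belongs to both closed half-lines and would be counted
      twice.\<close>
    have "AE x in lborel. x \<noteq> (0::real)"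
      by (rule AE_lborel_singleton)
    then show "AE x in lborel. f x = g x + g (- x)"
      by eventually_elim (auto simp: g_def indicator_def even)
    show "f \<in> borel_measurable lborel" using int by simp
    show "(\<lambda>x. g x + g (- x)) \<in> borel_measurable lborel"
      using g g' by (intro borel_measurable_add borel_measurable_integrable)
  qed
  also have "\<dots> = (LBINT x. g x) + (LBINT x. g (- x))"
    using g g' by (rule Bochner_Integration.integral_add)
  also have "(LBINT x. g (- x)) = (LBINT x. g x)"
    using lborel_integral_real_affine[of "-1" g 0] by simp
  finally have "(LBINT x. g x) = (LBINT x. f x) / 2" by simp
  moreover have "(g has_integral (LBINT x. g x)) UNIV"
    by (rule has_integral_integral_lborel[OF g])
  moreover have "g = (\<lambda>x. if x \<in> {0..} then f x else 0)"
    by (auto simp: g_def indicator_def)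
  ultimately have "((\<lambda>x. if x \<in> {0..} then f x else 0) has_integral (LBINT x. f x) / 2) UNIV"
    by (simp only:)
  then show ?thesis
    by (simp only: has_integral_restrict_UNIV)
qed

text \<open>Hidden in the product of the two series, this parity is evident in the expansion in (b +
  y)_M (b - y)_M.\<close>

lemma generating_coeff_minus:
  assumes "0 < Re a" "0 < Re b" "0 < Re c" "0 < Re d"
  shows "generating_coeff a b c d n (- y) = generating_coeff a b c d n y"
  unfolding generating_coeff_eq[OF assms] by (simp add: mult.commute)

lemma wilson_minus: "wilson k (- x) a b c h = wilson k x a b c h"
  by (simp add: wilson_finite_sum mult.commute)

lemma wilson_weight_minus: "wilson_weight a b c h (- s) = wilson_weight a b c h s"
  by (simp add: wilson_weight_def gamma_pair_def wilson_kernel_def mult.commute)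

text \<open>At \<open>x = 0\<close> both sides vanish: on the left because of division by \<open>Gamma 0 = 0\<close>.\<close>
lemma norm_square_conv_wilson_weight:
  assumes "image_mset cnj {#a, b, c, h#} = {#a, b, c, h#}"
  shows "of_real ((norm (Gamma (a + \<i> * of_real x) * Gamma (b + \<i> * of_real x)
                       * Gamma (c + \<i> * of_real x) * Gamma (h + \<i> * of_real x)
                       / Gamma (2 * \<i> * of_real x)))\<^sup>2) = wilson_weight a b c h (\<i> * of_real x)"
proof -
  define G where "G = (\<lambda>t. Gamma (t - \<i> * of_real x))"
  have "{#cnj a, cnj b, cnj c, cnj h#} = {#a, b, c, h#}"
    using assms by simp
  \<comment> \<open>Conjugation merely permutes the parameters, so it leaves the product of the
    Gamma(t - ix) unchanged.\<close>
  then have "prod_mset (image_mset G {#cnj a, cnj b, cnj c, cnj h#}) = prod_mset (image_mset G {#a, b, c, h#})"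
    by (simp only:)
  then have "G (cnj a) * G (cnj b) * G (cnj c) * G (cnj h) = G a * G b * G c * G h"
    by (simp add: mult_ac)
  moreover have "cnj (Gamma (t + \<i> * of_real x)) = G (cnj t)" for t
    by (simp add: cnj_Gamma G_def)
  moreover have "cnj (rGamma (2 * (\<i> * of_real x))) = rGamma (- 2 * (\<i> * of_real x))"
    by (simp add: cnj_rGamma)
  moreover have "u / Gamma (2 * \<i> * of_real x) = u * rGamma (2 * (\<i> * of_real x))" for u
    by (simp add: rGamma_inverse_Gamma divide_inverse mult.assoc)
  ultimately show ?thesis
    unfolding complex_norm_square wilson_weight_def gamma_pair_def wilson_kernel_def G_def
    by (simp only: complex_cnj_mult) (simp only: mult_ac)
qed

text \<open>For nonzero c the convergence of t is inherited from the hypothesis; for c = 0 both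
  sides are 0. Convergence of the final hypergeometric series is thus a by-product, and \<rho> = 0 <
  k requires no separate treatment.\<close>

lemma sums_cmult_suminf:
  fixes t :: "nat \<Rightarrow> complex"
  assumes "(\<lambda>n. c * t n) sums S"
  shows "S = c * suminf t"
proof (cases "c = 0")
  case True
  then show ?thesis using assms sums_unique2[of "\<lambda>_. 0" S 0] by simp
next
  case False
  then have "t sums (S / c)"
    using sums_divide[OF assms, of c] by simp
  then show ?thesis using False by (simp add: sums_iff)
qed

theorem corollary6p1:
  fixes k :: nat and \<rho> a b c d h :: complex
  assumes "norm \<rho> < 1"
    and "Re a > 0" and "Re b > 0" and "Re c > 0" and "Re d > 0" and "Re h > 0"
    and "image_mset cnj {#a, b, c, d#} = {#a, b, c, d#}"
    and "image_mset cnj {#a, b, c, h#} = {#a, b, c, h#}"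
  shows
    "((\<lambda>x::real.
         hypergeo [a + \<i> * of_real x, c + \<i> * of_real x] [a + c] \<rho>
       * hypergeo [b - \<i> * of_real x, d - \<i> * of_real x] [b + d] \<rho>
       * wilson k (of_real x) a b c h
       * of_real ((norm (Gamma (a + \<i> * of_real x) * Gamma (b + \<i> * of_real x)
                       * Gamma (c + \<i> * of_real x) * Gamma (h + \<i> * of_real x)
                       / Gamma (2 * \<i> * of_real x)))\<^sup>2))
      has_integral
       (2 * of_real pi
       * (Gamma (a + c) * Gamma (of_nat k + a + b) * Gamma (of_nat k + a + h)
          * Gamma (of_nat k + b + c) * Gamma (of_nat k + c + h) * Gamma (of_nat k + b + h)
          * pochhammer (of_nat k + a + b + c + d - 1) k
          / (pochhammer (b + d) k * Gamma (2 * of_nat k + a + b + c + h)))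
       * (if k = 0
          then hypergeo [d - h, a + b, b + c] [a + b + c + h, b + d] \<rho>
          else hypergeo
                 [d - h, 2 * of_nat k + a + b + c + d - 1, of_nat k + a + b, of_nat k + b + c]
                 [of_nat k + a + b + c + d - 1, 2 * of_nat k + a + b + c + h, of_nat k + b + d]
                 \<rho>)
       * \<rho> ^ k)) {0..}"
proof -
  note re = assms(2-6)
  define F where "F = (\<lambda>x::real. hypergeo [a + \<i> * of_real x, c + \<i> * of_real x] [a + c] \<rho> *
     hypergeo [b - \<i> * of_real x, d - \<i> * of_real x] [b + d] \<rho> * wilson k (of_real x) a b c h * wilson_weight a b c h (\<i> * of_real x))"
  \<comment> \<open>Half the constant of \<open>generating_moment\<close>, since the integral sought
    runs over the half line.\<close>
  define P where "P = 2 * of_real pi * (Gamma (a + c) * Gamma (a + b + of_nat k) * Gamma (a + h + of_nat k) *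
          Gamma (b + c + of_nat k) * Gamma (c + h + of_nat k) * Gamma (b + h + of_nat k)) /
        (pochhammer (b + d) k * Gamma (a + b + c + h + of_nat (2 * k)))"
  define z where "z = of_nat k + a + b + c + d - 1"
  define m where "m = (\<lambda>n. if n < k then 0 else 2 * P *
        (pochhammer (d - h) (n - k) * pochhammer (a + b + of_nat k) (n - k) * pochhammer (b + c + of_nat k) (n - k) *
         pochhammer (of_nat n + a + b + c + d - 1) k /
         (pochhammer (a + b + c + h + of_nat (2 * k)) (n - k) * pochhammer (b + d + of_nat k) (n - k) * fact (n - k))))"
  define t where "t = (\<lambda>N. pochhammer (d - h) N * pochhammer (a + b + of_nat k) N * pochhammer (b + c + of_nat k) N *
         pochhammer (z + of_nat N) k /
         (pochhammer (a + b + c + h + of_nat (2 * k)) N * pochhammer (b + d + of_nat k) N) * (\<rho> ^ N / fact N))"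
  define Y where "Y = (if k = 0
          then hypergeo [d - h, a + b, b + c] [a + b + c + h, b + d] \<rho>
          else hypergeo
                 [d - h, 2 * of_nat k + a + b + c + d - 1, of_nat k + a + b, of_nat k + b + c]
                 [of_nat k + a + b + c + d - 1, 2 * of_nat k + a + b + c + h, of_nat k + b + d]
                 \<rho>)"
  have P2: "2 * P = 4 * of_real pi * (Gamma (a + c) * Gamma (a + b + of_nat k) * Gamma (a + h + of_nat k) *
          Gamma (b + c + of_nat k) * Gamma (c + h + of_nat k) * Gamma (b + h + of_nat k)) /
        (pochhammer (b + d) k * Gamma (a + b + c + h + of_nat (2 * k)))"
    by (simp add: P_def)
  have "has_bochner_integral lborel
      (\<lambda>x. generating_coeff a b c d n (\<i> * of_real x) * wilson k (of_real x) a b c h * wilson_weight a b c h (\<i> * of_real x)) (m n)" for n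
    unfolding m_def P2 by (rule generating_moment[OF re])
  from generating_integral[OF re assms(1) this]
  have int: "integrable lborel F" and sums: "(\<lambda>n. m n * \<rho> ^ n) sums (LBINT x. F x)"
    unfolding F_def by blast+
  \<comment> \<open>The product of the two series is even because each coefficient of its power
    series in \<rho> is.\<close>
  have even: "F (- x) = F x" for x
  proof -
    have "(\<lambda>n. generating_coeff a b c d n (\<i> * of_real (- x)) * \<rho> ^ n) = (\<lambda>n. generating_coeff a b c d n (\<i> * of_real x) * \<rho> ^ n)"
      using generating_coeff_minus[OF re(1-4), of _ "\<i> * of_real x"] by simp
    note sums_unique2[OF generating_coeff_sums[OF re(1-4) assms(1), of "- x", unfolded this]
        generating_coeff_sums[OF re(1-4) assms(1), of x]]
    then show ?thesis
      using wilson_minus[of k "of_real x" a b c h] wilson_weight_minus[of a b c h "\<i> * of_real x"]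
      unfolding F_def by simp
  qed
  have "(\<lambda>N. m (N + k) * \<rho> ^ (N + k)) sums (LBINT x. F x)"
    using sums by (subst sums_zero_iff_shift) (auto simp: m_def)
  also have "(\<lambda>N. m (N + k) * \<rho> ^ (N + k)) = (\<lambda>N. (2 * P * \<rho> ^ k) * t N)"
  proof
    fix N
    have "of_nat (N + k) + a + b + c + d - 1 = z + of_nat N"
      by (simp add: z_def)
    then show "m (N + k) * \<rho> ^ (N + k) = (2 * P * \<rho> ^ k) * t N"
      by (simp add: m_def t_def power_add mult_ac del: of_nat_add)
  qed
  finally have t_sums: "(\<lambda>N. (2 * P * \<rho> ^ k) * t N) sums (LBINT x. F x)" .
  \<comment> \<open>The two cases reflect the cancellation convention: for k = 0 the number z may be
    0, so (z)_N must not appear in a denominator and t itself serves as y; for k > 0 its real part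
    is positive.\<close>
  have "\<exists>y. Y = suminf y \<and> (\<forall>N. t N = pochhammer z k * y N)"
  proof (cases "k = 0")
    case True
    then show ?thesis
      by (intro exI[of _ t]) (simp add: t_def Y_def hypergeo_altdef mult_ac)
  next
    case False
    have nz: "pochhammer z N \<noteq> 0" for N
      using re False by (intro pochhammer_neq_0) (auto simp: z_def intro!: add_nonneg_pos)
    define y where "y = (\<lambda>N. pochhammer (d - h) N * pochhammer (z + of_nat k) N * pochhammer (a + b + of_nat k) N * pochhammer (b + c + of_nat k) N /
         (pochhammer z N * pochhammer (a + b + c + h + of_nat (2 * k)) N * pochhammer (b + d + of_nat k) N) * (\<rho> ^ N / fact N))"
    have "Y = hypergeo [d - h, z + of_nat k, a + b + of_nat k, b + c + of_nat k]
        [z, a + b + c + h + of_nat (2 * k), b + d + of_nat k] \<rho>"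
      using False by (simp add: Y_def z_def algebra_simps)
    also have "\<dots> = suminf y"
      unfolding hypergeo_altdef y_def by (simp add: mult_ac)
    finally have Y: "Y = suminf y" .
    \<comment> \<open>Both sides equal (z)_(k+N). This trades the n-dependent factor (z + N)_k for
      the parameter pair z + k over z of the 4F3.\<close>
    have "pochhammer z k * pochhammer (z + of_nat k) N = pochhammer z N * pochhammer (z + of_nat N) k" for N
      by (simp only: pochhammer_product' [symmetric] add.commute)
    then have "pochhammer (z + of_nat N) k = pochhammer z k * pochhammer (z + of_nat k) N / pochhammer z N" for N
      using nz[of N] by (simp add: eq_divide_eq mult.commute)
    then have "t N = pochhammer z k * y N" for N
      by (simp add: t_def y_def mult_ac)
    with Y show ?thesis by blast
  qed
  then obtain y where y: "Y = suminf y" "\<And>N. t N = pochhammer z k * y N"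
    by blast
  have "(LBINT x. F x) = (2 * P * \<rho> ^ k * pochhammer z k) * Y"
    unfolding y(1) using t_sums by (intro sums_cmult_suminf) (simp add: y(2) mult.assoc)
  then have "(LBINT x. F x) / 2 = P * pochhammer z k * Y * \<rho> ^ k"
    by simp
  with has_integral_half_line_even[OF int even]
  have "(F has_integral (P * pochhammer z k * Y * \<rho> ^ k)) {0..}"
    by simp
  also have "P * pochhammer z k * Y * \<rho> ^ k = 2 * of_real pi
       * (Gamma (a + c) * Gamma (of_nat k + a + b) * Gamma (of_nat k + a + h)
          * Gamma (of_nat k + b + c) * Gamma (of_nat k + c + h) * Gamma (of_nat k + b + h)
          * pochhammer (of_nat k + a + b + c + d - 1) k
          / (pochhammer (b + d) k * Gamma (2 * of_nat k + a + b + c + h))) * Y * \<rho> ^ k"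
    by (simp add: P_def z_def add_ac)
  finally show ?thesis
    unfolding F_def Y_def norm_square_conv_wilson_weight[OF assms(8)] .
qed

end
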